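(* For each $p\in[1,\infty)$, $(\mathcal{H}^\infty_{\mathcal{N}^p},\nu^{p\mathcal{H}^\infty})$ is a Banach bounded-holomorphic ideal.
   Context: For complex Banach spaces $E,F$ and $U\subseteq E$ open, $\mathcal{H}^\infty(U,F)$ is the Banach space of all bounded holomorphic mappings $f\colon U\to F$ with the supremum norm $\|\cdot\|_\infty$, and $\mathcal{H}^\infty(U)=\mathcal{H}^\infty(U,\mathbb{C})$. $\mathcal{H}(V,U)$ denotes the set of holomorphic mappings from $V$ into $U$; $\mathcal{L}(F,G)$ the bounded linear operators; $B_X$ the closed unit ball of $X$. Let $p^*=p/(p-1)$ for $1<p<\infty$ and $p^*=\infty$ for $p=1$. $\ell_p(X)$ is the space of absolutely $p$-summable sequences in $X$ with norm $\|(x_n)\|_p=(\sum_n\|x_n\|^p)^{1/p}$. For $1\le q<\infty$, $\ell_q^{\mathrm{weak}}(X)$ is the Banach space of weakly $q$-summable sequences in $X$ with norm $\|(x_n)\|_q^{\mathrm{weak}}=\sup\{(\sum_n|\varphi(x_n)|^q)^{1/q}\colon\varphi\in B_{X^*}\}$; $\ell_\infty^{\mathrm{weak}}(X)$ is the space of bounded sequences in $X$ with norm $\sup_n\|x_n\|$. A holomorphic mapping $f\colon U\to F$ is right $p$-nuclear if there are $(g_n)\in\ell_{p^*}^{\mathrm{weak}}(\mathcal{H}^\infty(U))$ and $(y_n)\in\ell_p(F)$ such that $f=\sum_{n=1}^\infty g_n\cdot y_n$ in $(\mathcal{H}^\infty(U,F),\|\cdot\|_\infty)$, where $(g\cdot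 y)(x)=g(x)y$. $\mathcal{H}^\infty_{\mathcal{N}^p}(U,F)$ is the set of such mappings and $\nu^{p\mathcal{H}^\infty}(f)=\inf\{\|(g_n)\|_{p^*}^{\mathrm{weak}}\|(y_n)\|_p\}$ over all such representations. A bounded-holomorphic ideal is a subclass $\mathcal{I}^{\mathcal{H}^\infty}$ of the class $\mathcal{H}^\infty$ of bounded holomorphic mappings such that for all complex Banach spaces $E,F$ and every open $U\subseteq E$ the components $\mathcal{I}^{\mathcal{H}^\infty}(U,F):=\mathcal{I}^{\mathcal{H}^\infty}\cap\mathcal{H}^\infty(U,F)$ satisfy: (I1) $\mathcal{I}^{\mathcal{H}^\infty}(U,F)$ is a linear subspace of $\mathcal{H}^\infty(U,F)$; (I2) for any $g\in\mathcal{H}^\infty(U)$ and $y\in F$, the mapping $g\cdot y\colon x\mapsto g(x)y$ is in $\mathcal{I}^{\mathcal{H}^\infty}(U,F)$; (I3) if $H,G$ are complex Banach spaces, $V$ is an open subset of $H$, $h\in\mathcal{H}(V,U)$, $f\in\mathcal{I}^{\mathcal{H}^\infty}(U,F)$ and $S\in\mathcal{L}(F,G)$, then $S\circ f\circ h\in\mathcal{I}^{\mathcal{H}^\infty}(V,G)$. It is a Banach bounded-holomorphic ideal with respect to a function $\|\cdot\|_{\mathcal{I}^{\mathcal{H}^\infty}}\colon\mathcal{I}^{\mathcal{H}^\infty}\to[0,\infty)$ if moreover: (N1) each $(\mathcal{I}^{\mathcal{H}^\infty}(U,F),\|\cdot\|_{\mathcal{I}^{\mathcal{H}^\infty}})$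 is a Banach space and $\|f\|_\infty\le\|f\|_{\mathcal{I}^{\mathcal{H}^\infty}}$ for all its elements $f$; (N2) $\|g\cdot y\|_{\mathcal{I}^{\mathcal{H}^\infty}}=\|g\|_\infty\|y\|$ for $g\in\mathcal{H}^\infty(U)$, $y\in F$; (N3) in the situation of (I3), $\|S\circ f\circ h\|_{\mathcal{I}^{\mathcal{H}^\infty}}\le\|S\|\,\|f\|_{\mathcal{I}^{\mathcal{H}^\infty}}$. *)

theory Defs
  imports "HOL-Analysis.Analysis" "HOL-Library.Function_Algebras"
begin

section \<open>Complex Banach spaces\<close>

class complex_vector = ab_group_add +
  fixes scaleC :: "complex \<Rightarrow> 'a \<Rightarrow> 'a" (infixr \<open>*\<^sub>C\<close> 75)
  assumes scaleC_add_right: "a *\<^sub>C (x + y) = a *\<^sub>C x + a *\<^sub>C y"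
    and scaleC_add_left: "(a + b) *\<^sub>C x = a *\<^sub>C x + b *\<^sub>C x"
    and scaleC_scaleC: "a *\<^sub>C b *\<^sub>C x = (a * b) *\<^sub>C x"
    and scaleC_one: "1 *\<^sub>C x = x"

global_interpretation complex_vector: vector_space "scaleC :: complex \<Rightarrow> 'a \<Rightarrow> 'a::complex_vector"
  by standard (rule scaleC_add_right scaleC_add_left scaleC_scaleC scaleC_one)+

class complex_normed_vector = complex_vector + real_normed_vector +
  assumes scaleR_scaleC: "r *\<^sub>R x = complex_of_real r *\<^sub>C x"
    and norm_scaleC: "norm (a *\<^sub>C x) = cmod a * norm x"

class cbanach = complex_normed_vector + complete_space

instantiation complex :: cbanach
begin

definition scaleC_complex :: "complex \<Rightarrow> complex \<Rightarrow> complex"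
  where "scaleC_complex a x = a * x"

instance
  by standard (simp_all add: scaleC_complex_def algebra_simps scaleR_conv_of_real norm_mult)

end

instantiation "fun" :: (type, complex_vector) complex_vector
begin

definition scaleC_fun :: "complex \<Rightarrow> ('a \<Rightarrow> 'b) \<Rightarrow> 'a \<Rightarrow> 'b"
  where "scaleC_fun a f = (\<lambda>x. a *\<^sub>C f x)"

instance
  by standard (simp_all add: scaleC_fun_def fun_eq_iff scaleC_add_right scaleC_add_left
      scaleC_scaleC scaleC_one)

end

definition bounded_clinear :: "('a::complex_normed_vector \<Rightarrow> 'b::complex_normed_vector) \<Rightarrow> bool"
  where "bounded_clinear S \<longleftrightarrow> bounded_linear S \<and> (\<forall>a x. S (a *\<^sub>C x) = a *\<^sub>C S x)"


section \<open>Normed spaces given by a subspace and a norm\<close>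

text \<open>
  A space of mappings on an open set \<open>U\<close> depends on the term \<open>U\<close>, so it cannot be a type.
  Such spaces are given as a complex linear subspace \<open>X\<close> of an ambient vector space together
  with a function \<open>N\<close> of which only the values on \<open>X\<close> matter.
\<close>

definition norm_on :: "'a::complex_vector set \<Rightarrow> ('a \<Rightarrow> real) \<Rightarrow> bool"
  where "norm_on X N \<longleftrightarrow>
    (\<forall>x\<in>X. 0 \<le> N x) \<and>
    (\<forall>x\<in>X. N x = 0 \<longleftrightarrow> x = 0) \<and>
    (\<forall>a. \<forall>x\<in>X. N (a *\<^sub>C x) = cmod a * N x) \<and>
    (\<forall>x\<in>X. \<forall>y\<in>X. N (x + y) \<le> N x + N y)"

definition complete_on :: "'a::complex_vector set \<Rightarrow> ('a \<Rightarrow> real) \<Rightarrow> bool"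
  where "complete_on X N \<longleftrightarrow>
    (\<forall>s. range s \<subseteq> X \<and> (\<forall>e>0. \<exists>M. \<forall>m\<ge>M. \<forall>n\<ge>M. N (s m - s n) < e) \<longrightarrow>
      (\<exists>l\<in>X. (\<lambda>n. N (s n - l)) \<longlonglongrightarrow> 0))"

definition banach_space_on :: "'a::complex_vector set \<Rightarrow> ('a \<Rightarrow> real) \<Rightarrow> bool"
  where "banach_space_on X N \<longleftrightarrow>
    complex_vector.subspace X \<and> norm_on X N \<and> complete_on X N"

text \<open>
  Functionals are total functions on the ambient space; their values off \<open>X\<close> are irrelevant.
\<close>

definition clinear_functional_on :: "'a::complex_vector set \<Rightarrow> ('a \<Rightarrow> complex) \<Rightarrow> bool"
  where "clinear_functional_on X \<phi> \<longleftrightarrow>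
    (\<forall>x\<in>X. \<forall>y\<in>X. \<phi> (x + y) = \<phi> x + \<phi> y) \<and> (\<forall>a. \<forall>x\<in>X. \<phi> (a *\<^sub>C x) = a * \<phi> x)"

definition dual_on :: "'a::complex_vector set \<Rightarrow> ('a \<Rightarrow> real) \<Rightarrow> ('a \<Rightarrow> complex) set"
  where "dual_on X N =
    {\<phi>. clinear_functional_on X \<phi> \<and> (\<exists>C. \<forall>x\<in>X. cmod (\<phi> x) \<le> C * N x)}"

definition dual_ball_on :: "'a::complex_vector set \<Rightarrow> ('a \<Rightarrow> real) \<Rightarrow> ('a \<Rightarrow> complex) set"
  where "dual_ball_on X N =
    {\<phi>. clinear_functional_on X \<phi> \<and> (\<forall>x\<in>X. cmod (\<phi> x) \<le> N x)}"


section \<open>Sequence spaces\<close>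

definition conj_exponent :: "real \<Rightarrow> ereal"
  where "conj_exponent p = (if p = 1 then \<infinity> else ereal (p / (p - 1)))"

definition lp_seqs :: "real \<Rightarrow> (nat \<Rightarrow> 'a::real_normed_vector) set"
  where "lp_seqs p = {y. summable (\<lambda>n. norm (y n) powr p)}"

definition lp_norm :: "real \<Rightarrow> (nat \<Rightarrow> 'a::real_normed_vector) \<Rightarrow> real"
  where "lp_norm p y = (\<Sum>n. norm (y n) powr p) powr (1 / p)"

definition weak_lq_seqs ::
    "ereal \<Rightarrow> 'a::complex_vector set \<Rightarrow> ('a \<Rightarrow> real) \<Rightarrow> (nat \<Rightarrow> 'a) set"
  where "weak_lq_seqs q X N =
    {x. range x \<subseteq> X \<and>
      (if q = \<infinity> then bdd_above (range (\<lambda>n. N (x n)))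
       else (\<forall>\<phi>\<in>dual_on X N. summable (\<lambda>n. cmod (\<phi> (x n)) powr real_of_ereal q)))}"

text \<open>
  For finite \<open>q\<close> the supremum is one of real numbers. On a Banach space it is finite
  for every weakly \<open>q\<close>-summable sequence, by the uniform boundedness principle.
\<close>

definition weak_lq_norm ::
    "ereal \<Rightarrow> 'a::complex_vector set \<Rightarrow> ('a \<Rightarrow> real) \<Rightarrow> (nat \<Rightarrow> 'a) \<Rightarrow> real"
  where "weak_lq_norm q X N x =
    (if q = \<infinity> then (SUP n. N (x n))
     else (SUP \<phi>\<in>dual_ball_on X N.
       (\<Sum>n. cmod (\<phi> (x n)) powr real_of_ereal q) powr (1 / real_of_ereal q)))"


section \<open>Bounded holomorphic mappings\<close>

text \<open>Holomorphy on an open set is complex Frechet differentiability at each of its points.\<close>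

definition holomorphic_map ::
    "'e::complex_normed_vector set \<Rightarrow> ('e \<Rightarrow> 'f::complex_normed_vector) \<Rightarrow> bool"
  where "holomorphic_map U f \<longleftrightarrow>
    (\<forall>x\<in>U. \<exists>D. bounded_clinear D \<and> (f has_derivative D) (at x))"

text \<open>
  A mapping \<open>U \<rightarrow> F\<close> is represented by its extension by zero to all of \<open>E\<close>. Thus equality of
  mappings on \<open>U\<close> is equality of terms, and the linear structure is the pointwise one.
\<close>

definition zero_extend :: "'e set \<Rightarrow> ('e \<Rightarrow> 'f::zero) \<Rightarrow> 'e \<Rightarrow> 'f"
  where "zero_extend U f = (\<lambda>x. if x \<in> U then f x else 0)"

definition Hinf :: "'e::complex_normed_vector set \<Rightarrow> ('e \<Rightarrow> 'f::complex_normed_vector) set"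
  where "Hinf U =
    {f. holomorphic_map U f \<and> bounded (f ` U) \<and> (\<forall>x. x \<notin> U \<longrightarrow> f x = 0)}"

definition sup_norm :: "'e set \<Rightarrow> ('e \<Rightarrow> 'f::real_normed_vector) \<Rightarrow> real"
  where "sup_norm U f = (if U = {} then 0 else (SUP x\<in>U. norm (f x)))"

definition rank_one :: "('e \<Rightarrow> complex) \<Rightarrow> 'f::complex_vector \<Rightarrow> 'e \<Rightarrow> 'f" (infixl \<open>\<odot>\<close> 70)
  where "g \<odot> y = (\<lambda>x. g x *\<^sub>C y)"


section \<open>Right \<open>p\<close>-nuclear holomorphic mappings\<close>

definition nuclear_repr ::
    "real \<Rightarrow> 'e::complex_normed_vector set \<Rightarrow> ('e \<Rightarrow> 'f::complex_normed_vector) \<Rightarrow>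
      (nat \<Rightarrow> 'e \<Rightarrow> complex) \<Rightarrow> (nat \<Rightarrow> 'f) \<Rightarrow> bool"
  where "nuclear_repr p U f g y \<longleftrightarrow>
    g \<in> weak_lq_seqs (conj_exponent p) (Hinf U) (sup_norm U) \<and>
    y \<in> lp_seqs p \<and>
    (\<lambda>k. sup_norm U (f - (\<Sum>n<k. g n \<odot> y n))) \<longlonglongrightarrow> 0"

definition right_nuclear ::
    "real \<Rightarrow> 'e::complex_normed_vector set \<Rightarrow> ('e \<Rightarrow> 'f::complex_normed_vector) set"
  where "right_nuclear p U = {f \<in> Hinf U. \<exists>g y. nuclear_repr p U f g y}"

definition right_nuclear_norm ::
    "real \<Rightarrow> 'e::complex_normed_vector set \<Rightarrow> ('e \<Rightarrow> 'f::complex_normed_vector) \<Rightarrow> real"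
  where "right_nuclear_norm p U f =
    Inf {weak_lq_norm (conj_exponent p) (Hinf U) (sup_norm U) g * lp_norm p y | g y.
      nuclear_repr p U f g y}"


section \<open>Bounded-holomorphic ideals\<close>

text \<open>
  HOL cannot quantify over all Banach spaces inside a formula. The spaces \<open>E\<close>, \<open>F\<close>, \<open>H\<close>, \<open>G\<close> of
  the definition are therefore the type parameters \<open>'e\<close>, \<open>'f\<close>, \<open>'h\<close>, \<open>'g\<close>, and the class of
  mappings enters through its components \<open>I U\<close> of mappings \<open>U \<rightarrow> F\<close> and \<open>J V\<close> of mappings
  \<open>V \<rightarrow> G\<close>, with norms \<open>N U\<close> and \<open>M V\<close>. A family that is polymorphic in the two spaces is an
  ideal if the predicate holds for its instances at all type arguments, \<open>J\<close> and \<open>M\<close> being the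
  same polymorphic constants as \<open>I\<close> and \<open>N\<close>.
\<close>

definition bounded_holomorphic_ideal ::
    "('e::cbanach set \<Rightarrow> ('e \<Rightarrow> 'f::cbanach) set) \<Rightarrow>
      ('h::cbanach set \<Rightarrow> ('h \<Rightarrow> 'g::cbanach) set) \<Rightarrow> bool"
  where "bounded_holomorphic_ideal I J \<longleftrightarrow>
    (\<forall>U. open U \<longrightarrow> I U \<subseteq> Hinf U \<and> complex_vector.subspace (I U)) \<and>
    (\<forall>U g y. open U \<and> g \<in> Hinf U \<longrightarrow> g \<odot> y \<in> I U) \<and>
    (\<forall>U V h f S. open U \<and> open V \<and> holomorphic_map V h \<and> h ` V \<subseteq> U \<and>
      f \<in> I U \<and> bounded_clinear S \<longrightarrow> zero_extend V (S \<circ> f \<circ> h) \<in> J V)"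

definition banach_bounded_holomorphic_ideal ::
    "('e::cbanach set \<Rightarrow> ('e \<Rightarrow> 'f::cbanach) set) \<Rightarrow> ('e set \<Rightarrow> ('e \<Rightarrow> 'f) \<Rightarrow> real) \<Rightarrow>
      ('h::cbanach set \<Rightarrow> ('h \<Rightarrow> 'g::cbanach) set) \<Rightarrow> ('h set \<Rightarrow> ('h \<Rightarrow> 'g) \<Rightarrow> real) \<Rightarrow> bool"
  where "banach_bounded_holomorphic_ideal I N J M \<longleftrightarrow>
    bounded_holomorphic_ideal I J \<and>
    (\<forall>U. open U \<longrightarrow> banach_space_on (I U) (N U) \<and> (\<forall>f\<in>I U. sup_norm U f \<le> N U f)) \<and>
    (\<forall>U g y. open U \<and> g \<in> Hinf U \<longrightarrow> N U (g \<odot> y) = sup_norm U g * norm y) \<and>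
    (\<forall>U V h f S. open U \<and> open V \<and> holomorphic_map V h \<and> h ` V \<subseteq> U \<and>
      f \<in> I U \<and> bounded_clinear S \<longrightarrow>
      M V (zero_extend V (S \<circ> f \<circ> h)) \<le> onorm S * N U f)"

end

theory Submission
  imports Defs "HOL-Complex_Analysis.Cauchy_Integral_Formula"
begin

text \<open>
  Everything rests on replacing a nuclear representation \<open>f = (\<Sum>n. g n \<odot> y n)\<close> by one with explicit
  bounds: \<open>g\<close> has weak norm at most \<open>C\<close>, \<open>y\<close> has \<open>p\<close>-norm at most \<open>D\<close>, and the series
  converges pointwise to \<open>f\<close>. By Hoelder's inequality the series of the \<open>\<phi> (g n) *\<^sub>C y n\<close>
  converges uniformly for \<open>\<phi>\<close> in the unit ball of the dual of the space of scalar bounded holomorphic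
  functions (\<open>pairing_converges_uniformly\<close>). Two kinds of functionals matter.
  Point evaluations yield uniform convergence of the series and \<open>sup_norm U f \<le> C * D\<close>.
  Directional derivatives, which by Cauchy's inequality lie in a multiple of the dual ball, yield
  term-by-term differentiability. Hence every such series defines a bounded holomorphic mapping, which is
  nuclear with norm at most \<open>C * D\<close> (\<open>dominated_repr_imp_right_nuclear\<close>). In the other direction,
  the weak norm of \<open>g\<close> is a finite supremum by the uniform boundedness principle
  on the dual (\<open>weakly_summable_imp_uniform_bound\<close>), so every nuclear representation has
  such bounds.
  
  Rescaling \<open>g\<close> against \<open>y\<close>, one may assume for any \<open>b\<close> above the nuclear norm that the \<open>q\<close>-th powers of the
  \<open>\<phi> (g n)\<close> and the \<open>p\<close>-th powers of the \<open>norm (y n)\<close> both sum to at most \<open>b\<close>, where \<open>q\<close> is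
  conjugate to \<open>p\<close>; for \<open>p = 1\<close> the first condition becomes that the \<open>g n\<close> have norm at
  most \<open>1\<close>. Such bounds are additive
  when countably many representations are interleaved. So the nuclear norm is
  countably subadditive (\<open>right_nuclear_suminf\<close>), which contains the triangle inequality and
  completeness. The ideal properties come from composing a representation term by term
  (\<open>right_nuclear_compose\<close>), and the norm of \<open>g \<odot> y\<close> is pinned between the supremum norm and the value
  of the one-term representation (\<open>rank_one_right_nuclear\<close>).
\<close>

text \<open>
  Makes the convergence theorems for real Banach spaces available for series in complex ones.
\<close>

instance cbanach \<subseteq> banach ..

section \<open>Hoelder's inequality for finite sums\<close>

text \<open>
  Hoelder's inequality with given bounds in place of the norms, so that no roots occur. For
  positive \<open>C\<close> and \<open>D\<close> it is the sum of Young's inequalities for \<open>a i / C\<close> and \<open>b i / D\<close>; if one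
  of them is zero, every product vanishes.
\<close>

lemma Hoelder_sum_bound:
  fixes a b :: "'i \<Rightarrow> real"
  assumes pq: "p > 1" "q > 1" "1 / p + 1 / q = 1"
    and nonneg: "\<And>i. i \<in> A \<Longrightarrow> 0 \<le> a i" "\<And>i. i \<in> A \<Longrightarrow> 0 \<le> b i"
    and CD: "0 \<le> C" "0 \<le> D"
    and a: "(\<Sum>i\<in>A. a i powr q) \<le> C powr q"
    and b: "(\<Sum>i\<in>A. b i powr p) \<le> D powr p"
  shows "(\<Sum>i\<in>A. a i * b i) \<le> C * D"
proof (cases "finite A \<and> 0 < C \<and> 0 < D")
  case True
  have "(a i / C) * (b i / D) \<le> a i powr q / C powr q / q + b i powr p / D powr p / p"
    if "i \<in> A" for i
    using Youngs_inequality[of p q "b i / D" "a i / C"] True nonneg[OF that] pq CD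
    by (simp add: powr_divide mult.commute)
  then have "(\<Sum>i\<in>A. (a i / C) * (b i / D))
      \<le> (\<Sum>i\<in>A. a i powr q / C powr q / q + b i powr p / D powr p / p)"
    by (intro sum_mono)
  also have "\<dots> = (\<Sum>i\<in>A. a i powr q) / C powr q / q + (\<Sum>i\<in>A. b i powr p) / D powr p / p"
    by (simp add: sum.distrib sum_divide_distrib)
  also have "\<dots> \<le> 1 / q + 1 / p"
    using a b True pq by (intro add_mono divide_right_mono) auto
  finally have "(\<Sum>i\<in>A. a i * b i) / (C * D) \<le> 1"
    using pq by (simp add: sum_divide_distrib)
  then show ?thesis
    using True by (simp add: divide_simps)
next
  case False
  have "a i * b i = 0" if "finite A" "i \<in> A" for i
  proof -
    have "C = 0 \<or> D = 0" using False CD that by auto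
    then show ?thesis
    proof
      assume "C = 0"
      then have "(\<Sum>i\<in>A. a i powr q) = 0" using a by (simp add: antisym sum_nonneg)
      then show ?thesis using that by (simp add: sum_nonneg_eq_0_iff)
    next
      assume "D = 0"
      then have "(\<Sum>i\<in>A. b i powr p) = 0" using b by (simp add: antisym sum_nonneg)
      then show ?thesis using that by (simp add: sum_nonneg_eq_0_iff)
    qed
  qed
  then have "(\<Sum>i\<in>A. a i * b i) = 0"
    by (cases "finite A") (auto intro!: sum.neutral)
  then show ?thesis using CD by simp
qed

section \<open>Uniform boundedness of weakly summable sequences\<close>

lemma clinear_functional_on_add:
  "clinear_functional_on X \<phi> \<Longrightarrow> x \<in> X \<Longrightarrow> y \<in> X \<Longrightarrow> \<phi> (x + y) = \<phi> x + \<phi> y"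
  and clinear_functional_on_scale:
  "clinear_functional_on X \<phi> \<Longrightarrow> x \<in> X \<Longrightarrow> \<phi> (a *\<^sub>C x) = a * \<phi> x"
  by (auto simp: clinear_functional_on_def)

lemma dual_ball_on_scaled:
  assumes N: "\<And>x. x \<in> X \<Longrightarrow> 0 \<le> N x" and \<phi>: "\<phi> \<in> dual_on X N"
  obtains c \<psi> where "0 < c" "\<psi> \<in> dual_ball_on X N" "\<phi> = (\<lambda>x. of_real c * \<psi> x)"
proof -
  obtain C where C: "\<And>x. x \<in> X \<Longrightarrow> cmod (\<phi> x) \<le> C * N x" and lin: "clinear_functional_on X \<phi>"
    using \<phi> by (auto simp: dual_on_def)
  define c where "c = max C 1"
  have c: "0 < c" by (simp add: c_def)
  have "cmod (\<phi> x) \<le> c * N x" if "x \<in> X" for x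
    by (rule order_trans[OF C[OF that]]) (auto simp: c_def intro!: mult_right_mono N[OF that])
  then have "(\<lambda>x. \<phi> x / of_real c) \<in> dual_ball_on X N"
    using lin c by (auto simp: dual_ball_on_def clinear_functional_on_def norm_divide
        divide_simps mult.commute)
  with c show ?thesis
    by (intro that[of c "\<lambda>x. \<phi> x / of_real c"]) auto
qed

lemma dual_ball_subset_dual: "dual_ball_on X N \<subseteq> dual_on X N"
proof
  fix \<phi> assume "\<phi> \<in> dual_ball_on X N"
  then show "\<phi> \<in> dual_on X N"
    unfolding dual_on_def dual_ball_on_def by (auto intro!: exI[of _ 1])
qed

lemma zero_in_dual_ball:
  assumes "\<And>x. x \<in> X \<Longrightarrow> 0 \<le> N x"
  shows "(\<lambda>x. 0) \<in> dual_ball_on X N"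
  using assms by (auto simp: dual_ball_on_def clinear_functional_on_def)

lemma dual_on_combination:
  assumes "\<phi> \<in> dual_on X N" "\<psi> \<in> dual_on X N"
  shows "(\<lambda>x. \<phi> x + a * \<psi> x) \<in> dual_on X N"
proof -
  obtain C D where C: "\<And>x. x \<in> X \<Longrightarrow> cmod (\<phi> x) \<le> C * N x"
    and D: "\<And>x. x \<in> X \<Longrightarrow> cmod (\<psi> x) \<le> D * N x"
    using assms by (auto simp: dual_on_def)
  have "cmod (\<phi> x + a * \<psi> x) \<le> (C + cmod a * D) * N x" if "x \<in> X" for x
  proof -
    have "cmod (\<phi> x + a * \<psi> x) \<le> cmod (\<phi> x) + cmod a * cmod (\<psi> x)"
      using norm_triangle_ineq[of "\<phi> x" "a * \<psi> x"] by (simp add: norm_mult)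
    also have "\<dots> \<le> C * N x + cmod a * (D * N x)"
      using C[OF that] D[OF that] by (intro add_mono mult_left_mono) auto
    finally show ?thesis by (simp add: algebra_simps)
  qed
  moreover have "clinear_functional_on X (\<lambda>x. \<phi> x + a * \<psi> x)"
    using assms by (auto simp: dual_on_def clinear_functional_on_def algebra_simps)
  ultimately show ?thesis by (auto simp: dual_on_def)
qed

text \<open>
  The uniform boundedness principle for the sums \<open>F n \<phi>\<close> of the first \<open>n\<close> terms
  \<open>|\<phi> (x k)| powr q\<close>, which are pointwise bounded on the dual. The dual is complete, so
  the Baire argument takes place there. If the sums were unbounded on the unit ball, they
  would be unbounded on every ball: for a centre \<open>\<phi>\<close> and an increment \<open>r u\<close> the value
  at \<open>r u\<close> is at most the sum of the values at \<open>\<phi> + r u\<close> and \<open>\<phi> - r u\<close>. Each \<open>F n\<close> is continuous, so one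
  can choose nested balls, with radii tending to zero, on which some \<open>F n\<close> exceeds \<open>k\<close>.
  The limit of the centres lies in all of them and violates weak summability.
\<close>

lemma weakly_summable_imp_uniform_bound:
  fixes x :: "nat \<Rightarrow> 'a::complex_vector"
  assumes X: "complex_vector.subspace X"
    and N: "\<And>x. x \<in> X \<Longrightarrow> 0 \<le> N x" and x: "range x \<subseteq> X" and q: "q > 0"
    and summ: "\<And>\<phi>. \<phi> \<in> dual_on X N \<Longrightarrow> summable (\<lambda>n. cmod (\<phi> (x n)) powr q)"
  shows "\<exists>M. \<forall>\<phi>\<in>dual_ball_on X N. \<forall>n. (\<Sum>k<n. cmod (\<phi> (x k)) powr q) \<le> M"
proof (rule ccontr)
  assume "\<not> ?thesis"
  then have unbdd: "\<And>M. \<exists>\<phi>\<in>dual_ball_on X N. \<exists>n. M < (\<Sum>k<n. cmod (\<phi> (x k)) powr q)"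
    by (auto simp: not_le)
  define near where "near \<phi> r \<psi> \<longleftrightarrow> (\<forall>z\<in>X. cmod (\<psi> z - \<phi> z) \<le> r * N z)" for \<phi> r and \<psi> :: "'a \<Rightarrow> complex"
  define F where "F n \<phi> = (\<Sum>k<n. cmod (\<phi> (x k)) powr q)" for n \<phi>
  have near_trans: "near \<phi> (r + s) \<theta>" if "near \<phi> r \<psi>" "near \<psi> s \<theta>" for \<phi> \<psi> \<theta> r s
    unfolding near_def
  proof
    fix z assume "z \<in> X"
    have "cmod (\<theta> z - \<phi> z) \<le> cmod (\<theta> z - \<psi> z) + cmod (\<psi> z - \<phi> z)"
      using norm_triangle_ineq[of "\<theta> z - \<psi> z" "\<psi> z - \<phi> z"] by simp
    also have "\<dots> \<le> s * N z + r * N z"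
      using that \<open>z \<in> X\<close> by (intro add_mono) (auto simp: near_def)
    finally show "cmod (\<theta> z - \<phi> z) \<le> (r + s) * N z" by (simp add: algebra_simps)
  qed
  have near_mono: "near \<phi> s \<psi>" if "near \<phi> r \<psi>" "r \<le> s" for \<phi> r s \<psi>
    using that(1) unfolding near_def by (auto intro: order_trans[OF _ mult_right_mono[OF that(2) N]])
  \<comment> \<open>Unboundedness on the unit ball spreads to every ball, by reflection in the centre.\<close>
  have large_nearby: "\<exists>\<psi>\<in>dual_on X N. near \<phi> r \<psi> \<and> (\<exists>n. K < F n \<psi>)"
    if \<phi>: "\<phi> \<in> dual_on X N" and r: "0 < r" for \<phi> r K
  proof (rule ccontr)
    assume "\<not> ?thesis"
    then have small: "F n \<psi> \<le> K" if "\<psi> \<in> dual_on X N" "near \<phi> r \<psi>" for \<psi> n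
      using that by (auto simp: not_less)
    obtain u n where u: "u \<in> dual_ball_on X N" and large: "2 * K / r powr q < F n u"
      using unbdd[of "2 * K / r powr q"] unfolding F_def by auto
    define pl mi where "pl = (\<lambda>z. \<phi> z + of_real r * u z)" and "mi = (\<lambda>z. \<phi> z + (- of_real r) * u z)"
    have dual: "pl \<in> dual_on X N" "mi \<in> dual_on X N"
      unfolding pl_def mi_def using \<phi> u dual_ball_subset_dual by (blast intro: dual_on_combination)+
    have near: "near \<phi> r pl" "near \<phi> r mi"
      using u r by (auto simp: near_def pl_def mi_def dual_ball_on_def norm_mult)
    have "r powr q * cmod (u z) powr q \<le> cmod (pl z) powr q + cmod (mi z) powr q" for z
    proof -
      have "2 * (r * cmod (u z)) = cmod (pl z - mi z)"
        using r by (simp add: pl_def mi_def norm_mult flip: distrib_right mult_2)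
      also have "\<dots> \<le> cmod (pl z) + cmod (mi z)" by (rule norm_triangle_ineq4)
      finally have "r * cmod (u z) \<le> cmod (pl z) \<or> r * cmod (u z) \<le> cmod (mi z)" by linarith
      then have "(r * cmod (u z)) powr q \<le> cmod (pl z) powr q \<or>
          (r * cmod (u z)) powr q \<le> cmod (mi z) powr q"
        using r q by (auto intro!: powr_mono2)
      then show ?thesis using r by (auto simp: powr_mult add_increasing add_increasing2)
    qed
    then have "r powr q * F n u \<le> F n pl + F n mi"
      unfolding F_def sum_distrib_left by (simp add: sum_mono flip: sum.distrib)
    also have "\<dots> \<le> 2 * K"
      using small[OF dual(1) near(1), of n] small[OF dual(2) near(2), of n] by simp
    finally show False using large r by (simp add: divide_simps mult.commute)
  qed
  \<comment> \<open>Pointwise convergence on the finitely many vectors that occur in \<open>F n\<close> suffices for its continuity.\<close>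
  have stays_large: "\<exists>d>0. \<forall>\<psi>. near \<phi> d \<psi> \<longrightarrow> K < F n \<psi>" if large: "K < F n \<phi>" for \<phi> n K
  proof (rule ccontr)
    assume neg: "\<not> ?thesis"
    have "\<exists>\<psi>. near \<phi> (inverse (real (Suc m))) \<psi> \<and> F n \<psi> \<le> K" for m
      using neg by (metis not_less inverse_positive_iff_positive of_nat_0_less_iff zero_less_Suc)
    then obtain \<psi> where \<psi>: "\<And>m. near \<phi> (inverse (real (Suc m))) (\<psi> m)" "\<And>m. F n (\<psi> m) \<le> K"
      by metis
    have "(\<lambda>m. \<psi> m (x k)) \<longlonglongrightarrow> \<phi> (x k)" for k
    proof -
      have "(\<lambda>m. inverse (real (Suc m)) * N (x k)) \<longlonglongrightarrow> 0"
        by (rule tendsto_mult_left_zero[OF LIMSEQ_inverse_real_of_nat])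
      moreover have "\<forall>\<^sub>F m in sequentially.
          norm (\<psi> m (x k) - \<phi> (x k)) \<le> inverse (real (Suc m)) * N (x k)"
      proof (intro always_eventually allI)
        fix m
        have "x k \<in> X" using x by auto
        with \<psi>(1)[of m] show "norm (\<psi> m (x k) - \<phi> (x k)) \<le> inverse (real (Suc m)) * N (x k)"
          unfolding near_def by (rule bspec)
      qed
      ultimately have "(\<lambda>m. \<psi> m (x k) - \<phi> (x k)) \<longlonglongrightarrow> 0"
        by (rule Lim_null_comparison[rotated])
      then show ?thesis by (rule LIM_zero_cancel)
    qed
    then have "(\<lambda>m. F n (\<psi> m)) \<longlonglongrightarrow> F n \<phi>"
      unfolding F_def using q by (intro tendsto_sum tendsto_powr' tendsto_norm tendsto_const) simp_all
    then have "F n \<phi> \<le> K"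
      by (rule LIMSEQ_le_const2) (use \<psi>(2) in auto)
    with large show False by simp
  qed
  \<comment> \<open>The pair \<open>(\<phi>, r)\<close> stands for the closed ball with centre \<open>\<phi>\<close> and radius \<open>r\<close>; \<open>Q k\<close> makes some \<open>F n\<close> exceed \<open>k\<close> on the next ball.\<close>
  define P where "P k = (\<lambda>(\<phi>, r). \<phi> \<in> dual_on X N \<and> 0 < r \<and> r \<le> inverse (real (Suc k)))" for k
  define Q where "Q k = (\<lambda>(\<phi>, r) (\<phi>', r'). near \<phi> r \<phi>' \<and> (\<forall>\<psi>. near \<phi>' r' \<psi> \<longrightarrow> near \<phi> r \<psi>) \<and>
      (\<exists>n. \<forall>\<psi>. near \<phi>' r' \<psi> \<longrightarrow> real k < F n \<psi>))" for k
  have "\<exists>s. \<forall>k. P k (s k) \<and> Q k (s k) (s (Suc k))"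
  proof (rule dependent_nat_choice)
    show "\<exists>s. P 0 s"
      using zero_in_dual_ball[of X N] N dual_ball_subset_dual
      by (intro exI[of _ "((\<lambda>x. 0), 1)"]) (auto simp: P_def)
  next
    fix s k assume "P k s"
    then obtain \<phi> r where s: "s = (\<phi>, r)" and \<phi>: "\<phi> \<in> dual_on X N" and r: "0 < r"
      by (cases s) (auto simp: P_def)
    obtain \<psi> n where \<psi>: "\<psi> \<in> dual_on X N" "near \<phi> (r/2) \<psi>" "real k < F n \<psi>"
      using large_nearby[OF \<phi>, of "r/2" "real k"] r by auto
    obtain d where d: "0 < d" "\<And>\<theta>. near \<psi> d \<theta> \<Longrightarrow> real k < F n \<theta>"
      using stays_large[OF \<psi>(3)] by auto
    define r' where "r' = min d (min (r/2) (inverse (real (Suc (Suc k)))))"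
    have r': "0 < r'" "r' \<le> d" "r' \<le> r/2" "r' \<le> inverse (real (Suc (Suc k)))"
      using d r by (auto simp: r'_def)
    have "near \<phi> r \<theta>" if "near \<psi> r' \<theta>" for \<theta>
      using near_trans[OF \<psi>(2), of "r/2" \<theta>] near_mono[OF that r'(3)] by simp
    moreover have "real k < F n \<theta>" if "near \<psi> r' \<theta>" for \<theta>
      using d(2) near_mono[OF that r'(2)] by blast
    moreover have "near \<phi> r \<psi>" using near_mono[OF \<psi>(2), of r] r by simp
    ultimately have "P (Suc k) (\<psi>, r') \<and> Q k s (\<psi>, r')"
      using \<psi> r' s unfolding P_def Q_def by auto
    then show "\<exists>t. P (Suc k) t \<and> Q k s t" by blast
  qed
  then obtain s where s: "\<And>k. P k (s k)" "\<And>k. Q k (s k) (s (Suc k))" by blast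
  define \<Phi> r where "\<Phi> k = fst (s k)" and "r k = snd (s k)" for k
  have \<Phi>: "\<Phi> k \<in> dual_on X N" and r: "0 < r k" "r k \<le> inverse (real (Suc k))" for k
    using s(1)[of k] by (auto simp: P_def \<Phi>_def r_def split: prod.splits)
  have step: "near (\<Phi> k) (r k) \<psi>" if "near (\<Phi> (Suc k)) (r (Suc k)) \<psi>" for k \<psi>
    using s(2)[of k] that by (auto simp: Q_def \<Phi>_def r_def split: prod.splits)
  have large: "\<exists>n. \<forall>\<psi>. near (\<Phi> (Suc k)) (r (Suc k)) \<psi> \<longrightarrow> real k < F n \<psi>" for k
    using s(2)[of k] by (auto simp: Q_def \<Phi>_def r_def split: prod.splits)
  have nested: "near (\<Phi> k) (r k) \<psi>" if "near (\<Phi> (k + j)) (r (k + j)) \<psi>" for j k \<psi>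
    using that by (induction j) (auto dest: step)
  have in_ball: "near (\<Phi> k) (r k) (\<Phi> m)" if "k \<le> m" for k m
  proof -
    have "near (\<Phi> m) (r m) (\<Phi> m)" using r(1)[of m] N by (simp add: near_def)
    then show ?thesis using nested[of k "m - k"] that by simp
  qed
  have r0: "r \<longlonglongrightarrow> 0"
    using r by (intro Lim_null_comparison[OF _ LIMSEQ_inverse_real_of_nat]) (auto simp: less_imp_le)
  have "convergent (\<lambda>k. \<Phi> k z)" if z: "z \<in> X" for z
  proof (rule Cauchy_convergent, rule metric_CauchyI)
    fix e :: real assume e: "0 < e"
    have "(\<lambda>k. r k * N z) \<longlonglongrightarrow> 0 * N z" by (intro tendsto_mult r0 tendsto_const)
    then have "\<forall>\<^sub>F k in sequentially. r k * N z < e / 2"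
      using e by (intro order_tendstoD) auto
    then obtain k where k: "r k * N z < e / 2" by (auto simp: eventually_sequentially)
    have "dist (\<Phi> m z) (\<Phi> n z) < e" if "m \<ge> k" "n \<ge> k" for m n
    proof -
      have "dist (\<Phi> m z) (\<Phi> n z) \<le> cmod (\<Phi> m z - \<Phi> k z) + cmod (\<Phi> n z - \<Phi> k z)"
        using dist_triangle2[of "\<Phi> m z" "\<Phi> n z" "\<Phi> k z"] by (simp add: dist_norm)
      also have "\<dots> \<le> r k * N z + r k * N z"
        using in_ball that z by (intro add_mono) (auto simp: near_def)
      finally show ?thesis using k by linarith
    qed
    then show "\<exists>M. \<forall>m\<ge>M. \<forall>n\<ge>M. dist (\<Phi> m z) (\<Phi> n z) < e" by blast
  qed
  then obtain \<phi> where lim: "\<And>z. z \<in> X \<Longrightarrow> (\<lambda>k. \<Phi> k z) \<longlonglongrightarrow> \<phi> z"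
    unfolding convergent_def by metis
  have limball: "near (\<Phi> k) (r k) \<phi>" for k
    unfolding near_def
  proof
    fix z assume z: "z \<in> X"
    have "(\<lambda>m. cmod (\<Phi> m z - \<Phi> k z)) \<longlonglongrightarrow> cmod (\<phi> z - \<Phi> k z)"
      by (intro tendsto_intros lim z)
    then show "cmod (\<phi> z - \<Phi> k z) \<le> r k * N z"
      by (rule LIMSEQ_le_const2) (use in_ball z in \<open>auto simp: near_def\<close>)
  qed
  have lin\<Phi>: "clinear_functional_on X (\<Phi> k)" for k
    using \<Phi> by (auto simp: dual_on_def)
  have "\<phi> (y + z) = \<phi> y + \<phi> z" if "y \<in> X" "z \<in> X" for y z
  proof (rule LIMSEQ_unique)
    show "(\<lambda>k. \<Phi> k (y + z)) \<longlonglongrightarrow> \<phi> (y + z)"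
      using X that by (intro lim complex_vector.subspace_add)
    show "(\<lambda>k. \<Phi> k (y + z)) \<longlonglongrightarrow> \<phi> y + \<phi> z"
      using that by (simp add: clinear_functional_on_add[OF lin\<Phi>] tendsto_add lim)
  qed
  moreover have "\<phi> (a *\<^sub>C z) = a * \<phi> z" if "z \<in> X" for a z
  proof (rule LIMSEQ_unique)
    show "(\<lambda>k. \<Phi> k (a *\<^sub>C z)) \<longlonglongrightarrow> \<phi> (a *\<^sub>C z)"
      using X that by (intro lim complex_vector.subspace_scale)
    show "(\<lambda>k. \<Phi> k (a *\<^sub>C z)) \<longlonglongrightarrow> a * \<phi> z"
      using that by (simp add: clinear_functional_on_scale[OF lin\<Phi>] tendsto_mult lim)
  qed
  moreover have "\<exists>C. \<forall>z\<in>X. cmod (\<phi> z) \<le> C * N z"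
  proof -
    obtain C where C: "\<And>z. z \<in> X \<Longrightarrow> cmod (\<Phi> 0 z) \<le> C * N z"
      using \<Phi>[of 0] by (auto simp: dual_on_def)
    have "cmod (\<phi> z) \<le> (C + r 0) * N z" if "z \<in> X" for z
    proof -
      have "cmod (\<phi> z) \<le> cmod (\<Phi> 0 z) + cmod (\<phi> z - \<Phi> 0 z)"
        by (rule norm_triangle_sub)
      also have "\<dots> \<le> C * N z + r 0 * N z"
        using C limball that by (intro add_mono) (auto simp: near_def)
      finally show ?thesis by (simp add: algebra_simps)
    qed
    then show ?thesis by blast
  qed
  ultimately have "\<phi> \<in> dual_on X N"
    by (simp add: dual_on_def clinear_functional_on_def)
  then have summ\<phi>: "summable (\<lambda>n. cmod (\<phi> (x n)) powr q)"
    by (rule summ)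
  obtain k where k: "(\<Sum>n. cmod (\<phi> (x n)) powr q) \<le> real k"
    using real_arch_simple by blast
  obtain n where "real k < F n \<phi>"
    using large[of k] limball by blast
  also have "F n \<phi> \<le> (\<Sum>n. cmod (\<phi> (x n)) powr q)"
    unfolding F_def by (rule sum_le_suminf[OF summ\<phi>]) auto
  finally show False using k by simp
qed

section \<open>Bounds on the weak norm of a sequence\<close>

text \<open>
  The inequality \<open>weak norm \<le> C\<close> for the exponent conjugate to \<open>p\<close>, expressed by finite sums:
  in this form it carries over to interleaved sequences, and it yields Hoelder estimates directly.
\<close>

definition weakly_dominated ::
    "real \<Rightarrow> 'a::complex_vector set \<Rightarrow> ('a \<Rightarrow> real) \<Rightarrow> (nat \<Rightarrow> 'a) \<Rightarrow> real \<Rightarrow> bool"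
  where "weakly_dominated p X N x C \<longleftrightarrow> range x \<subseteq> X \<and>
    (if p = 1 then \<forall>n. N (x n) \<le> C
     else \<forall>\<phi>\<in>dual_ball_on X N. \<forall>n.
       (\<Sum>k<n. cmod (\<phi> (x k)) powr (p / (p - 1))) \<le> C powr (p / (p - 1)))"

text \<open>
  For \<open>p > 1\<close> a supremum of reals bounds its members only if the set is bounded above; that
  is what the uniform boundedness principle provides.
\<close>

lemma weakly_dominated_weak_lq_norm:
  assumes p: "1 \<le> p" and X: "complex_vector.subspace X"
    and N: "\<And>x. x \<in> X \<Longrightarrow> 0 \<le> N x" and x: "x \<in> weak_lq_seqs (conj_exponent p) X N"
  shows "weakly_dominated p X N x (weak_lq_norm (conj_exponent p) X N x)"
    and "0 \<le> weak_lq_norm (conj_exponent p) X N x"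
proof -
  let ?W = "weak_lq_norm (conj_exponent p) X N x"
  have "weakly_dominated p X N x ?W \<and> 0 \<le> ?W"
  proof (cases "p = 1")
    case True
    have rx: "range x \<subseteq> X" and bdd: "bdd_above (range (\<lambda>n. N (x n)))"
      using x True by (auto simp: weak_lq_seqs_def conj_exponent_def)
    have W: "?W = (SUP n. N (x n))"
      using True by (simp add: weak_lq_norm_def conj_exponent_def)
    have "N (x n) \<le> ?W" for n
      unfolding W by (rule cSUP_upper[OF _ bdd]) simp
    then show ?thesis
      using True rx N[of "x 0"] order_trans[of 0 "N (x 0)" ?W]
      by (auto simp: weakly_dominated_def image_subset_iff)
  next
    case False
    define q where "q = p / (p - 1)"
    have q: "q > 0" using p False by (simp add: q_def)
    have rx: "range x \<subseteq> X"
      and summ: "\<And>\<phi>. \<phi> \<in> dual_on X N \<Longrightarrow> summable (\<lambda>n. cmod (\<phi> (x n)) powr q)"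
      using x False by (auto simp: weak_lq_seqs_def conj_exponent_def q_def)
    obtain M where M: "\<And>\<phi> n. \<phi> \<in> dual_ball_on X N \<Longrightarrow> (\<Sum>k<n. cmod (\<phi> (x k)) powr q) \<le> M"
      using weakly_summable_imp_uniform_bound[where N = N, OF X N rx q summ] by blast
    define S where "S \<phi> = (\<Sum>k. cmod (\<phi> (x k)) powr q)" for \<phi>
    have W: "?W = (SUP \<phi>\<in>dual_ball_on X N. S \<phi> powr (1 / q))"
      using False by (simp add: weak_lq_norm_def conj_exponent_def q_def S_def)
    have summb: "summable (\<lambda>n. cmod (\<phi> (x n)) powr q)" if "\<phi> \<in> dual_ball_on X N" for \<phi>
      using that summ dual_ball_subset_dual by blast
    have S: "0 \<le> S \<phi>" "S \<phi> \<le> M" if "\<phi> \<in> dual_ball_on X N" for \<phi>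
      unfolding S_def using summb[OF that] M[OF that] by (auto intro: suminf_nonneg suminf_le_const)
    have bdd: "bdd_above ((\<lambda>\<phi>. S \<phi> powr (1 / q)) ` dual_ball_on X N)"
      by (rule bdd_aboveI2[where M = "M powr (1 / q)"]) (use S q in \<open>auto intro!: powr_mono2\<close>)
    have upper: "S \<phi> powr (1 / q) \<le> ?W" if "\<phi> \<in> dual_ball_on X N" for \<phi>
      unfolding W using that bdd by (intro cSUP_upper)
    have W0: "0 \<le> ?W"
      using upper[OF zero_in_dual_ball[where X = X and N = N, OF N]] powr_ge_zero order_trans by metis
    have "(\<Sum>k<n. cmod (\<phi> (x k)) powr q) \<le> ?W powr q" if "\<phi> \<in> dual_ball_on X N" for \<phi> n
    proof -
      have "(\<Sum>k<n. cmod (\<phi> (x k)) powr q) \<le> S \<phi>"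
        unfolding S_def by (intro sum_le_suminf summb that) auto
      also have "\<dots> = (S \<phi> powr (1 / q)) powr q"
        using q S(1)[OF that] by (simp add: powr_powr)
      also have "\<dots> \<le> ?W powr q"
        using q upper[OF that] by (intro powr_mono2) auto
      finally show ?thesis .
    qed
    then show ?thesis
      using False rx W0 by (simp add: weakly_dominated_def q_def)
  qed
  then show "weakly_dominated p X N x ?W" "0 \<le> ?W" by auto
qed

text \<open>
  Every functional is a multiple of one in the dual ball, so bounds on the
  dual ball give weak summability against the whole dual.
\<close>

lemma weakly_dominated_imp_weak_lq:
  assumes p: "1 \<le> p" and N: "\<And>x. x \<in> X \<Longrightarrow> 0 \<le> N x" and C: "0 \<le> C"
    and dom: "weakly_dominated p X N x C"
  shows "x \<in> weak_lq_seqs (conj_exponent p) X N" and "weak_lq_norm (conj_exponent p) X N x \<le> C"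
proof -
  have "x \<in> weak_lq_seqs (conj_exponent p) X N \<and> weak_lq_norm (conj_exponent p) X N x \<le> C"
  proof (cases "p = 1")
    case True
    then have "N (x n) \<le> C" for n using dom by (simp add: weakly_dominated_def)
    then show ?thesis
      using True dom
      by (auto simp: weak_lq_seqs_def weak_lq_norm_def conj_exponent_def weakly_dominated_def
          intro!: cSUP_least bdd_aboveI2[where M = C])
  next
    case False
    define q where "q = p / (p - 1)"
    have q: "q > 0" using p False by (simp add: q_def)
    have bound: "(\<Sum>k<n. cmod (\<phi> (x k)) powr q) \<le> C powr q" if "\<phi> \<in> dual_ball_on X N" for \<phi> n
      using dom that False by (simp add: weakly_dominated_def q_def)
    have summb: "summable (\<lambda>n. cmod (\<phi> (x n)) powr q)" if "\<phi> \<in> dual_ball_on X N" for \<phi>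
      using bound[OF that] by (intro summableI_nonneg_bounded[where x = "C powr q"]) auto
    have "summable (\<lambda>n. cmod (\<phi> (x n)) powr q)" if \<phi>: "\<phi> \<in> dual_on X N" for \<phi>
    proof -
      obtain c \<psi> where c: "0 < c" "\<psi> \<in> dual_ball_on X N" "\<phi> = (\<lambda>x. of_real c * \<psi> x)"
        using dual_ball_on_scaled[OF N \<phi>] by blast
      then show ?thesis
        using summable_mult[OF summb[OF c(2)], of "c powr q"] by (simp add: norm_mult powr_mult)
    qed
    moreover have "(\<Sum>k. cmod (\<phi> (x k)) powr q) powr (1 / q) \<le> C" if "\<phi> \<in> dual_ball_on X N" for \<phi>
    proof -
      have "(\<Sum>k. cmod (\<phi> (x k)) powr q) powr (1 / q) \<le> (C powr q) powr (1 / q)"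
        using q summb[OF that] bound[OF that]
        by (intro powr_mono2 suminf_le_const suminf_nonneg) auto
      then show ?thesis using q C by (simp add: powr_powr)
    qed
    ultimately show ?thesis
      using False dom zero_in_dual_ball[where X = X and N = N, OF N]
      by (auto simp: weak_lq_seqs_def weak_lq_norm_def conj_exponent_def weakly_dominated_def
          q_def[symmetric] intro!: cSUP_least)
  qed
  then show "x \<in> weak_lq_seqs (conj_exponent p) X N" "weak_lq_norm (conj_exponent p) X N x \<le> C"
    by auto
qed

text \<open>
  Hoelder's inequality for \<open>p > 1\<close>, and \<open>|\<phi> (x k)| \<le> N (x k) \<le> C\<close> for \<open>p = 1\<close>. The freedom
  in the index set \<open>A\<close> matters: with \<open>A\<close> in a tail, \<open>D\<close> can be taken small.
\<close>

lemma weakly_dominated_pairing: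
  assumes p: "1 \<le> p" and C: "0 \<le> C" and dom: "weakly_dominated p X N x C"
    and \<phi>: "\<phi> \<in> dual_ball_on X N" and A: "finite A"
    and D: "0 \<le> D" "(\<Sum>k\<in>A. b k powr p) \<le> D powr p" and b: "\<And>k. 0 \<le> b k"
  shows "(\<Sum>k\<in>A. cmod (\<phi> (x k)) * b k) \<le> C * D"
proof (cases "p = 1")
  case True
  have "cmod (\<phi> (x k)) \<le> C" for k
  proof -
    have "cmod (\<phi> (x k)) \<le> N (x k)"
      using \<phi> dom by (auto simp: dual_ball_on_def weakly_dominated_def)
    also have "\<dots> \<le> C" using True dom by (simp add: weakly_dominated_def)
    finally show ?thesis .
  qed
  then have "(\<Sum>k\<in>A. cmod (\<phi> (x k)) * b k) \<le> (\<Sum>k\<in>A. C * b k)"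
    using b by (intro sum_mono mult_right_mono) auto
  also have "\<dots> = C * (\<Sum>k\<in>A. b k powr p)"
    using True b by (simp add: sum_distrib_left)
  also have "\<dots> \<le> C * D"
    using C D True by (intro mult_left_mono) auto
  finally show ?thesis .
next
  case False
  then have p1: "p > 1" using p by simp
  obtain n where n: "A \<subseteq> {..<n}"
    using A finite_nat_bounded by blast
  let ?q = "p / (p - 1)"
  have "(\<Sum>k\<in>A. cmod (\<phi> (x k)) powr ?q) \<le> (\<Sum>k<n. cmod (\<phi> (x k)) powr ?q)"
    using n by (intro sum_mono2) auto
  also have "\<dots> \<le> C powr ?q"
    using dom \<phi> False by (simp add: weakly_dominated_def)
  finally show ?thesis
    using p1 C D b by (intro Hoelder_sum_bound[where p = p and q = ?q]) (auto simp: field_simps)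
qed

text \<open>
  A contraction \<open>T\<close> preserves the bound because its transpose maps the dual ball to the dual ball.
\<close>

lemma weakly_dominated_map:
  assumes dom: "weakly_dominated p X N x C"
    and T: "\<And>z. z \<in> X \<Longrightarrow> T z \<in> Y" "\<And>z. z \<in> X \<Longrightarrow> M (T z) \<le> N z"
    and dual: "\<And>\<phi>. \<phi> \<in> dual_ball_on Y M \<Longrightarrow> (\<lambda>z. \<phi> (T z)) \<in> dual_ball_on X N"
  shows "weakly_dominated p Y M (\<lambda>n. T (x n)) C"
proof -
  have x: "x n \<in> X" for n using dom by (auto simp: weakly_dominated_def)
  show ?thesis
  proof (cases "p = 1")
    case True
    then show ?thesis
      using dom x T order_trans[OF T(2)[OF x]] by (auto simp: weakly_dominated_def)
  next
    case False
    then show ?thesis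
      using dom x T(1) dual by (fastforce simp: weakly_dominated_def)
  qed
qed

lemma weakly_dominated_scale:
  assumes X: "complex_vector.subspace X" and N: "norm_on X N"
    and C: "0 \<le> C" and dom: "weakly_dominated p X N x C"
  shows "weakly_dominated p X N (\<lambda>n. a *\<^sub>C x n) (cmod a * C)"
proof -
  have x: "x n \<in> X" for n using dom by (auto simp: weakly_dominated_def)
  then have ax: "a *\<^sub>C x n \<in> X" for n using X by (intro complex_vector.subspace_scale)
  show ?thesis
  proof (cases "p = 1")
    case True
    then show ?thesis
      using dom ax x N by (auto simp: weakly_dominated_def norm_on_def intro!: mult_left_mono)
  next
    case False
    have "(\<Sum>k<n. cmod (\<phi> (a *\<^sub>C x k)) powr (p / (p - 1))) \<le> (cmod a * C) powr (p / (p - 1))"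
      if \<phi>: "\<phi> \<in> dual_ball_on X N" for \<phi> n
    proof -
      have "\<phi> (a *\<^sub>C x k) = a * \<phi> (x k)" for k
        using \<phi> x by (auto simp: dual_ball_on_def clinear_functional_on_def)
      then have "(\<Sum>k<n. cmod (\<phi> (a *\<^sub>C x k)) powr (p / (p - 1)))
          = cmod a powr (p / (p - 1)) * (\<Sum>k<n. cmod (\<phi> (x k)) powr (p / (p - 1)))"
        by (simp add: norm_mult powr_mult sum_distrib_left)
      also have "\<dots> \<le> cmod a powr (p / (p - 1)) * C powr (p / (p - 1))"
        using dom \<phi> False by (intro mult_left_mono) (auto simp: weakly_dominated_def)
      finally show ?thesis using C by (simp add: powr_mult)
    qed
    then show ?thesis
      using False ax by (auto simp: weakly_dominated_def)
  qed
qed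

text \<open>
  Any initial segment of the enumeration of the pairs lies in a finite square, whose sum can be
  taken row by row.
\<close>

lemma sum_prod_decode_le:
  fixes u :: "nat \<Rightarrow> nat \<Rightarrow> real"
  assumes u: "\<And>j i. 0 \<le> u j i" and le: "\<And>j n. (\<Sum>i<n. u j i) \<le> b j" and b: "summable b"
  shows "(\<Sum>n<m. case prod_decode n of (j, i) \<Rightarrow> u j i) \<le> suminf b"
proof -
  have b0: "0 \<le> b j" for j using le[where n = 0] by simp
  have fin: "finite (prod_decode ` {..<m})" by simp
  obtain K where K: "fst ` prod_decode ` {..<m} \<union> snd ` prod_decode ` {..<m} \<subseteq> {..<K}"
    using finite_nat_bounded[of "fst ` prod_decode ` {..<m} \<union> snd ` prod_decode ` {..<m}"] by auto
  have "(\<Sum>n<m. case prod_decode n of (j, i) \<Rightarrow> u j i) = (\<Sum>(j, i)\<in>prod_decode ` {..<m}. u j i)"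
    by (subst sum.reindex) (auto simp: inj_prod_decode)
  also have "\<dots> \<le> (\<Sum>(j, i)\<in>{..<K} \<times> {..<K}. u j i)"
    using K u by (intro sum_mono2) (auto simp: image_subset_iff mem_Times_iff)
  also have "\<dots> = (\<Sum>j<K. \<Sum>i<K. u j i)"
    by (simp add: sum.cartesian_product)
  also have "\<dots> \<le> (\<Sum>j<K. b j)"
    by (intro sum_mono le)
  also have "\<dots> \<le> suminf b"
    by (intro sum_le_suminf b) (auto simp: b0)
  finally show ?thesis .
qed

text \<open>
  With \<open>q\<close> conjugate to \<open>p\<close>, the bound \<open>b powr (1 - 1 / p)\<close> says that the \<open>q\<close>-th powers sum to at most
  \<open>b\<close>, so these \<open>b j\<close> simply add up. For \<open>p = 1\<close> the same expression is \<open>1\<close>, the common bound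
  of the rows, provided that the \<open>b j\<close> do not vanish: \<open>0 powr 0\<close> is \<open>0\<close>.
\<close>

lemma weakly_dominated_interleave:
  assumes p: "1 \<le> p" and dom: "\<And>j. weakly_dominated p X N (x j) (b j powr (1 - 1 / p))"
    and b: "\<And>j. 0 < b j" "summable b"
  shows "weakly_dominated p X N (\<lambda>n. case prod_decode n of (j, i) \<Rightarrow> x j i)
    (suminf b powr (1 - 1 / p))"
proof -
  have x: "x j i \<in> X" for j i using dom[of j] by (auto simp: weakly_dominated_def)
  have B: "0 < suminf b" using b by (simp add: suminf_pos)
  show ?thesis
  proof (cases "p = 1")
    case True
    have "b j \<noteq> 0" "suminf b \<noteq> 0" for j
      using b(1)[of j] B by auto
    with True show ?thesis
      using x dom by (auto simp: weakly_dominated_def split: prod.split)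
  next
    case False
    define q where "q = p / (p - 1)"
    have pw: "(c powr (1 - 1 / p)) powr q = c" if "0 < c" for c :: real
      using p False that by (simp add: q_def powr_powr field_simps)
    have "(\<Sum>n<m. cmod (\<phi> (case prod_decode n of (j, i) \<Rightarrow> x j i)) powr q) \<le> suminf b"
      if "\<phi> \<in> dual_ball_on X N" for \<phi> m
    proof -
      have "(\<Sum>i<n. cmod (\<phi> (x j i)) powr q) \<le> b j" for j n
        using dom[of j] that False pw[OF b(1)[of j]] by (auto simp: weakly_dominated_def q_def)
      then have "(\<Sum>n<m. case prod_decode n of (j, i) \<Rightarrow> cmod (\<phi> (x j i)) powr q) \<le> suminf b"
        by (intro sum_prod_decode_le b) auto
      then show ?thesis by (simp add: case_prod_unfold)
    qed
    then show ?thesis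
      using x False pw[OF B] by (auto simp: weakly_dominated_def q_def split: prod.split)
  qed
qed

section \<open>The normed space of bounded holomorphic mappings\<close>

lemma bounded_linear_scaleC_left:
  fixes y :: "'f::complex_normed_vector"
  shows "bounded_linear (\<lambda>c. c *\<^sub>C y)"
  by (rule bounded_linear_intro[where K = "norm y"])
     (simp_all add: scaleC_add_left scaleR_scaleC scaleC_scaleC norm_scaleC scaleC_complex_def)

lemma bounded_clinear_scaleC_right:
  "bounded_clinear (\<lambda>y::'f::complex_normed_vector. a *\<^sub>C y)"
proof -
  have "bounded_linear (\<lambda>y::'f. a *\<^sub>C y)"
    by (rule bounded_linear_intro[where K = "cmod a"])
       (simp_all add: scaleC_add_right scaleR_scaleC scaleC_scaleC norm_scaleC mult.commute)
  then show ?thesis by (simp add: bounded_clinear_def scaleC_scaleC mult.commute)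
qed

lemma Hinf_holomorphic: "f \<in> Hinf U \<Longrightarrow> holomorphic_map U f"
  and Hinf_zero: "f \<in> Hinf U \<Longrightarrow> x \<notin> U \<Longrightarrow> f x = 0"
  by (auto simp: Hinf_def)

lemma sup_norm_le:
  assumes "\<And>x. x \<in> U \<Longrightarrow> norm (f x) \<le> M" "0 \<le> M"
  shows "sup_norm U f \<le> M"
  using assms by (auto simp: sup_norm_def intro!: cSUP_least)

lemma norm_le_sup_norm:
  assumes "f \<in> Hinf U"
  shows "norm (f x) \<le> sup_norm U f"
proof -
  have bdd: "bdd_above ((\<lambda>x. norm (f x)) ` U)"
    using assms by (auto simp: Hinf_def bounded_iff bdd_above_def)
  have inU: "norm (f x) \<le> sup_norm U f" if "x \<in> U" for x
    using that bdd by (auto simp: sup_norm_def intro!: cSUP_upper)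
  show ?thesis
  proof (cases "x \<in> U")
    case False
    have "0 \<le> sup_norm U f"
    proof (cases "U = {}")
      case False
      then obtain z where "z \<in> U" by auto
      from norm_ge_zero inU[OF this] show ?thesis by (rule order_trans)
    qed (simp add: sup_norm_def)
    with False assms show ?thesis by (simp add: Hinf_zero)
  qed (rule inU)
qed

lemma HinfI:
  assumes "holomorphic_map U f" "\<And>x. x \<in> U \<Longrightarrow> norm (f x) \<le> M" "\<And>x. x \<notin> U \<Longrightarrow> f x = 0"
  shows "f \<in> Hinf U"
  using assms by (auto simp: Hinf_def bounded_iff)

lemma subspace_Hinf: "complex_vector.subspace (Hinf U :: ('e::complex_normed_vector \<Rightarrow> 'f::complex_normed_vector) set)"
proof (rule complex_vector.subspaceI)
  have "holomorphic_map U (0 :: 'e \<Rightarrow> 'f)"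
    unfolding holomorphic_map_def
    by (intro ballI exI[of _ "\<lambda>h. 0"]) (auto simp: bounded_clinear_def zero_fun_def)
  then show "(0 :: 'e \<Rightarrow> 'f) \<in> Hinf U"
    by (rule HinfI[where M = 0]) auto
next
  fix f g :: "'e \<Rightarrow> 'f" assume f: "f \<in> Hinf U" and g: "g \<in> Hinf U"
  have "holomorphic_map U (f + g)"
    unfolding holomorphic_map_def
  proof
    fix x assume "x \<in> U"
    then obtain D E where "bounded_clinear D" "(f has_derivative D) (at x)"
      "bounded_clinear E" "(g has_derivative E) (at x)"
      using f g unfolding Hinf_def holomorphic_map_def by blast
    then show "\<exists>D. bounded_clinear D \<and> (f + g has_derivative D) (at x)"
      by (intro exI[of _ "\<lambda>h. D h + E h"])
         (auto simp: bounded_clinear_def plus_fun_def scaleC_add_right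
           intro!: bounded_linear_add has_derivative_add)
  qed
  moreover have "norm ((f + g) x) \<le> sup_norm U f + sup_norm U g" for x
    using norm_le_sup_norm[OF f, of x] norm_le_sup_norm[OF g, of x] norm_triangle_ineq[of "f x" "g x"]
    by simp
  ultimately show "f + g \<in> Hinf U"
    using f g by (intro HinfI) (auto simp: Hinf_zero)
next
  fix c and f :: "'e \<Rightarrow> 'f" assume f: "f \<in> Hinf U"
  have "holomorphic_map U (c *\<^sub>C f)"
    unfolding holomorphic_map_def
  proof
    fix x assume "x \<in> U"
    then obtain D where D: "bounded_clinear D" "(f has_derivative D) (at x)"
      using f unfolding Hinf_def holomorphic_map_def by blast
    have bl: "bounded_linear (\<lambda>y::'f. c *\<^sub>C y)"
      using bounded_clinear_scaleC_right by (auto simp: bounded_clinear_def)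
    show "\<exists>D. bounded_clinear D \<and> (c *\<^sub>C f has_derivative D) (at x)"
    proof (intro exI conjI)
      show "bounded_clinear (\<lambda>h. c *\<^sub>C D h)"
        using D(1) bounded_linear_compose[OF bl, of D]
        by (auto simp: bounded_clinear_def scaleC_scaleC mult.commute)
      show "(c *\<^sub>C f has_derivative (\<lambda>h. c *\<^sub>C D h)) (at x)"
        using bounded_linear.has_derivative[OF bl D(2)] by (simp add: scaleC_fun_def)
    qed
  qed
  moreover have "norm ((c *\<^sub>C f) x) \<le> cmod c * sup_norm U f" for x
    using norm_le_sup_norm[OF f, of x] by (simp add: scaleC_fun_def norm_scaleC mult_left_mono)
  ultimately show "c *\<^sub>C f \<in> Hinf U"
    using f by (intro HinfI) (auto simp: Hinf_zero scaleC_fun_def)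
qed

lemma sup_norm_nonneg: "f \<in> Hinf U \<Longrightarrow> 0 \<le> sup_norm U f"
  by (rule order_trans[OF norm_ge_zero norm_le_sup_norm])

lemma sup_norm_scale_le:
  assumes "f \<in> Hinf U"
  shows "sup_norm U (c *\<^sub>C f) \<le> cmod c * sup_norm U f"
  using assms norm_le_sup_norm[OF assms] sup_norm_nonneg[OF assms]
  by (intro sup_norm_le) (auto simp: scaleC_fun_def norm_scaleC intro!: mult_left_mono)

lemma norm_on_Hinf: "norm_on (Hinf U) (sup_norm U :: ('e::complex_normed_vector \<Rightarrow> 'f::complex_normed_vector) \<Rightarrow> real)"
  unfolding norm_on_def
proof (intro conjI ballI allI)
  fix f g :: "'e \<Rightarrow> 'f" and c assume f: "f \<in> Hinf U"
  show "0 \<le> sup_norm U f" using f by (rule sup_norm_nonneg)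
  show "sup_norm U f = 0 \<longleftrightarrow> f = 0"
  proof
    assume "sup_norm U f = 0"
    with norm_le_sup_norm[OF f] show "f = 0" by (auto simp: fun_eq_iff)
  qed (auto simp: sup_norm_def)
  show "sup_norm U (c *\<^sub>C f) = cmod c * sup_norm U f"
  proof (cases "c = 0")
    case True
    then show ?thesis by (simp add: sup_norm_def scaleC_fun_def)
  next
    case False
    have "sup_norm U (inverse c *\<^sub>C (c *\<^sub>C f)) \<le> cmod (inverse c) * sup_norm U (c *\<^sub>C f)"
      by (intro sup_norm_scale_le complex_vector.subspace_scale subspace_Hinf f)
    then have "cmod c * sup_norm U f \<le> sup_norm U (c *\<^sub>C f)"
      using False by (simp add: scaleC_scaleC scaleC_one norm_divide field_simps)
    with sup_norm_scale_le[OF f] show ?thesis by (rule antisym)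
  qed
next
  fix f g :: "'e \<Rightarrow> 'f" assume f: "f \<in> Hinf U" and g: "g \<in> Hinf U"
  have "norm ((f + g) x) \<le> sup_norm U f + sup_norm U g" for x
    using norm_le_sup_norm[OF f, of x] norm_le_sup_norm[OF g, of x] norm_triangle_ineq[of "f x" "g x"]
    by simp
  then show "sup_norm U (f + g) \<le> sup_norm U f + sup_norm U g"
    using sup_norm_nonneg[OF f] sup_norm_nonneg[OF g] by (intro sup_norm_le) auto
qed

text \<open>
  For \<open>x\<close> outside \<open>U\<close> this holds as well, because evaluation there is the zero functional.
\<close>

lemma evaluation_in_dual_ball: "(\<lambda>g. g x) \<in> dual_ball_on (Hinf U) (sup_norm U)"
  by (auto simp: dual_ball_on_def clinear_functional_on_def scaleC_fun_def scaleC_complex_def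
      norm_le_sup_norm)

lemma rank_one_in_Hinf:
  assumes g: "g \<in> Hinf U"
  shows "g \<odot> y \<in> Hinf U"
proof (rule HinfI)
  show "holomorphic_map U (g \<odot> y)"
    unfolding holomorphic_map_def
  proof
    fix x assume "x \<in> U"
    then obtain D where D: "bounded_clinear D" "(g has_derivative D) (at x)"
      using g unfolding Hinf_def holomorphic_map_def by blast
    show "\<exists>D. bounded_clinear D \<and> (g \<odot> y has_derivative D) (at x)"
    proof (intro exI conjI)
      show "bounded_clinear (\<lambda>h. D h *\<^sub>C y)"
        using D(1) bounded_linear_compose[OF bounded_linear_scaleC_left, of D y]
        by (auto simp: bounded_clinear_def scaleC_scaleC scaleC_complex_def)
      show "(g \<odot> y has_derivative (\<lambda>h. D h *\<^sub>C y)) (at x)"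
        unfolding rank_one_def
        by (rule bounded_linear.has_derivative[OF bounded_linear_scaleC_left D(2)])
    qed
  qed
  show "norm ((g \<odot> y) x) \<le> sup_norm U g * norm y" for x
    using norm_le_sup_norm[OF g, of x] by (simp add: rank_one_def norm_scaleC mult_right_mono)
  show "(g \<odot> y) x = 0" if "x \<notin> U" for x
    using Hinf_zero[OF g that] by (simp add: rank_one_def)
qed

lemma zero_extend_comp_in_Hinf:
  assumes V: "open V" and h: "holomorphic_map V h" "h ` V \<subseteq> U" and f: "f \<in> Hinf U"
  shows "zero_extend V (f \<circ> h) \<in> Hinf V"
proof (rule HinfI)
  show "holomorphic_map V (zero_extend V (f \<circ> h))"
    unfolding holomorphic_map_def
  proof
    fix x assume x: "x \<in> V"
    obtain D where D: "bounded_clinear D" "(h has_derivative D) (at x)"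
      using h x unfolding holomorphic_map_def by blast
    obtain E where E: "bounded_clinear E" "(f has_derivative E) (at (h x))"
      using h x f unfolding Hinf_def holomorphic_map_def by blast
    show "\<exists>D. bounded_clinear D \<and> (zero_extend V (f \<circ> h) has_derivative D) (at x)"
    proof (intro exI conjI)
      show "bounded_clinear (\<lambda>v. E (D v))"
        using D(1) E(1) bounded_linear_compose[of E D] by (auto simp: bounded_clinear_def)
      have "((\<lambda>v. f (h v)) has_derivative (\<lambda>v. E (D v))) (at x)"
        by (rule has_derivative_compose[OF D(2) E(2)])
      then show "(zero_extend V (f \<circ> h) has_derivative (\<lambda>v. E (D v))) (at x)"
        by (rule has_derivative_transform_within_open[OF _ V x]) (simp add: zero_extend_def)
    qed
  qed
  show "norm (zero_extend V (f \<circ> h) x) \<le> sup_norm U f" for x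
    using norm_le_sup_norm[OF f] sup_norm_nonneg[OF f] by (simp add: zero_extend_def)
qed (simp add: zero_extend_def)

text \<open>
  The one-variable Cauchy inequality on the complex line through \<open>x\<close> in direction \<open>h\<close>, on which
  the disc of radius \<open>r / norm h\<close> stays in \<open>U\<close>.
\<close>

lemma Cauchy_estimate_derivative:
  assumes r: "0 < r" "cball x r \<subseteq> U" and g: "g \<in> Hinf U" and D: "(g has_derivative D) (at x)"
  shows "cmod (D h) * r \<le> sup_norm U g * norm h"
proof (cases "h = 0")
  case True
  then show ?thesis using has_derivative_bounded_linear[OF D] by (simp add: linear_simps)
next
  case False
  define R where "R = r / norm h"
  have R: "0 < R" "R * norm h = r" using r False by (auto simp: R_def)
  define \<psi> where "\<psi> = (\<lambda>t. g (x + t *\<^sub>C h))"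
  have line: "x + t *\<^sub>C h \<in> U" if "cmod t \<le> R" for t
  proof -
    have "norm (t *\<^sub>C h) \<le> r"
      using that R by (metis norm_scaleC mult_right_mono norm_ge_zero)
    then show ?thesis using r by (auto simp: dist_norm)
  qed
  have deriv: "(\<psi> has_field_derivative E h) (at t)"
    if E: "bounded_clinear E" "(g has_derivative E) (at (x + t *\<^sub>C h))" for t E
  proof -
    have "((\<lambda>t. x + t *\<^sub>C h) has_derivative (\<lambda>s. s *\<^sub>C h)) (at t)"
      by (auto intro!: derivative_eq_intros bounded_linear.has_derivative[OF bounded_linear_scaleC_left]
          bounded_linear_imp_has_derivative bounded_linear_scaleC_left)
    from has_derivative_compose[OF this E(2)]
    have "(\<psi> has_derivative (\<lambda>s. E (s *\<^sub>C h))) (at t)"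
      by (simp add: \<psi>_def)
    moreover have "(\<lambda>s. E (s *\<^sub>C h)) = (*) (E h)"
      using E(1) by (auto simp: bounded_clinear_def scaleC_complex_def mult.commute)
    ultimately show ?thesis by (simp add: has_field_derivative_def)
  qed
  have diff: "\<psi> field_differentiable at t" if t: "cmod t \<le> R" for t
  proof -
    obtain E where "bounded_clinear E" "(g has_derivative E) (at (x + t *\<^sub>C h))"
      using Hinf_holomorphic[OF g] line[OF t] by (auto simp: holomorphic_map_def)
    from deriv[OF this] show ?thesis by (auto simp: field_differentiable_def)
  qed
  have "\<psi> holomorphic_on cball 0 R"
    by (auto simp: holomorphic_on_def intro!: field_differentiable_at_within diff)
  then have "norm ((deriv ^^ 1) \<psi> 0) \<le> fact 1 * sup_norm U g / R ^ 1"
    using R norm_le_sup_norm[OF g]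
    by (intro Cauchy_inequality holomorphic_on_imp_continuous_on)
       (auto intro: holomorphic_on_subset simp: \<psi>_def)
  moreover have "deriv \<psi> 0 = D h"
  proof -
    have "x \<in> U" using r by auto
    then obtain E where E: "bounded_clinear E" "(g has_derivative E) (at x)"
      using Hinf_holomorphic[OF g] by (auto simp: holomorphic_map_def)
    then have "deriv \<psi> 0 = E h"
      using deriv[of E 0] by (intro DERIV_imp_deriv) auto
    also have "E = D" using E(2) D by (rule has_derivative_unique)
    finally show ?thesis .
  qed
  ultimately have "cmod (D h) * R \<le> sup_norm U g"
    using R by (simp add: field_simps)
  then have "cmod (D h) * R * norm h \<le> sup_norm U g * norm h"
    by (intro mult_right_mono) auto
  then show ?thesis using R by (simp add: mult.assoc)
qed

text \<open>
  By the Cauchy estimate a suitably scaled directional derivative at a point is a functional in the dual ball.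
  A weak bound on a sequence of functions thus controls their derivatives exactly as it controls
  their values.
\<close>

lemma derivative_in_dual_ball:
  fixes x :: "'e::complex_normed_vector"
  assumes r: "0 < r" "cball x r \<subseteq> U" and c: "0 \<le> c" "c * norm h \<le> r"
  shows "(\<lambda>g. of_real c * frechet_derivative g (at x) h) \<in> dual_ball_on (Hinf U) (sup_norm U)"
proof -
  have x: "x \<in> U" using r by auto
  have D: "(g has_derivative frechet_derivative g (at x)) (at x)" if "g \<in> Hinf U" for g :: "'e \<Rightarrow> complex"
    using Hinf_holomorphic[OF that] x unfolding holomorphic_map_def
    by (meson differentiableI frechet_derivative_works)
  have "frechet_derivative (f + g) (at x) h = frechet_derivative f (at x) h + frechet_derivative g (at x) h"
    if "f \<in> Hinf U" "g \<in> Hinf U" for f g :: "'e \<Rightarrow> complex"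
  proof -
    have "((f + g) has_derivative (\<lambda>h. frechet_derivative f (at x) h + frechet_derivative g (at x) h)) (at x)"
      unfolding plus_fun_def by (intro has_derivative_add D that)
    from frechet_derivative_at[OF this] show ?thesis by metis
  qed
  moreover have "frechet_derivative (a *\<^sub>C g) (at x) h = a * frechet_derivative g (at x) h"
    if "g \<in> Hinf U" for a and g :: "'e \<Rightarrow> complex"
  proof -
    have "((a *\<^sub>C g) has_derivative (\<lambda>h. a * frechet_derivative g (at x) h)) (at x)"
      unfolding scaleC_fun_def scaleC_complex_def by (intro has_derivative_mult_right D that)
    from frechet_derivative_at[OF this] show ?thesis by metis
  qed
  moreover have "cmod (of_real c * frechet_derivative g (at x) h) \<le> sup_norm U g"
    if "g \<in> Hinf U" for g :: "'e \<Rightarrow> complex"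
  proof -
    let ?d = "cmod (frechet_derivative g (at x) h)"
    have "c * (?d * r) \<le> c * (sup_norm U g * norm h)"
      using Cauchy_estimate_derivative[OF r that D[OF that]] c by (intro mult_left_mono) auto
    also have "\<dots> = sup_norm U g * (c * norm h)" by simp
    also have "\<dots> \<le> sup_norm U g * r"
      using c sup_norm_nonneg[OF that] by (intro mult_left_mono) auto
    finally have "c * ?d * r \<le> sup_norm U g * r" by (simp only: mult.assoc)
    then show ?thesis using r c by (simp add: norm_mult)
  qed
  ultimately show ?thesis
    by (auto simp: dual_ball_on_def clinear_functional_on_def algebra_simps)
qed

section \<open>Series of products of weakly and strongly summable sequences\<close>

text \<open>
  A sequence \<open>g\<close> with weak norm at most \<open>C\<close> and a sequence \<open>y\<close> with \<open>p\<close>-norm at most \<open>D\<close>. Each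
  functional \<open>\<phi>\<close> in the dual ball turns them into the vector-valued series of the terms
  \<open>\<phi> (g k) *\<^sub>C y k\<close>.
\<close>

locale dominated_series =
  fixes p :: real and X :: "'a::complex_vector set" and N :: "'a \<Rightarrow> real"
    and g :: "nat \<Rightarrow> 'a" and C :: real and y :: "nat \<Rightarrow> 'f::cbanach" and D :: real
  assumes p: "1 \<le> p" and C: "0 \<le> C" and D: "0 \<le> D"
    and dom: "weakly_dominated p X N g C"
    and y: "\<And>n. (\<Sum>k<n. norm (y k) powr p) \<le> D powr p"
begin

lemma lp_summable: "summable (\<lambda>k. norm (y k) powr p)"
  using y by (intro summableI_nonneg_bounded[where x = "D powr p"]) auto

lemma pairing_le:
  assumes "\<phi> \<in> dual_ball_on X N" "finite A"
    "0 \<le> D'" "(\<Sum>k\<in>A. norm (y k) powr p) \<le> D' powr p"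
  shows "(\<Sum>k\<in>A. norm (\<phi> (g k) *\<^sub>C y k)) \<le> C * D'"
  using weakly_dominated_pairing[OF p C dom assms(1,2,3,4)] by (simp add: norm_scaleC)

lemma pairing_abs_summable:
  assumes "\<phi> \<in> dual_ball_on X N"
  shows "summable (\<lambda>k. norm (\<phi> (g k) *\<^sub>C y k))"
  using pairing_le[OF assms finite_lessThan D y]
  by (intro summableI_nonneg_bounded[where x = "C * D"]) auto

lemma pairing_summable:
  "\<phi> \<in> dual_ball_on X N \<Longrightarrow> summable (\<lambda>k. \<phi> (g k) *\<^sub>C y k)"
  by (rule summable_norm_cancel[OF pairing_abs_summable])

lemma norm_pairing_le:
  assumes "\<phi> \<in> dual_ball_on X N"
  shows "norm (\<Sum>k. \<phi> (g k) *\<^sub>C y k) \<le> C * D"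
proof -
  have "norm (\<Sum>k. \<phi> (g k) *\<^sub>C y k) \<le> (\<Sum>k. norm (\<phi> (g k) *\<^sub>C y k))"
    by (rule summable_norm[OF pairing_abs_summable[OF assms]])
  also have "\<dots> \<le> C * D"
    by (intro suminf_le_const pairing_abs_summable pairing_le assms finite_lessThan D y)
  finally show ?thesis .
qed

text \<open>
  Uniformity over the dual ball: the tail of the series from \<open>n\<close> on is at most \<open>C\<close> times the
  \<open>p\<close>-norm of the tail of \<open>y\<close>, which does not involve the functional.
\<close>

lemma pairing_converges_uniformly:
  assumes e: "0 < e"
  shows "\<exists>M. \<forall>\<phi>\<in>dual_ball_on X N. \<forall>n\<ge>M.
    norm ((\<Sum>k<n. \<phi> (g k) *\<^sub>C y k) - (\<Sum>k. \<phi> (g k) *\<^sub>C y k)) \<le> e"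
proof -
  \<comment> \<open>The summand \<open>1\<close> covers the case \<open>C = 0\<close>.\<close>
  define D' where "D' = e / (C + 1)"
  have D': "0 < D'" "C * D' \<le> e"
    using e C by (auto simp: D'_def field_simps)
  obtain M where M: "\<And>m n. M \<le> m \<Longrightarrow> norm (\<Sum>k=m..<n. norm (y k) powr p) < D' powr p"
  proof -
    have "0 < D' powr p" using D' by simp
    with lp_summable[unfolded summable_Cauchy] show ?thesis using that by blast
  qed
  show ?thesis
  proof (intro exI[of _ M] ballI allI impI)
    fix \<phi> n assume \<phi>: "\<phi> \<in> dual_ball_on X N" and n: "M \<le> n"
    let ?u = "\<lambda>k. \<phi> (g k) *\<^sub>C y k"
    have summ: "summable (\<lambda>k. norm (?u (k + n)))"
      using pairing_abs_summable[OF \<phi>] summable_iff_shift[of "\<lambda>k. norm (?u k)"] by blast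
    have "(\<Sum>k<n. ?u k) - (\<Sum>k. ?u k) = - (\<Sum>k. ?u (k + n))"
      by (simp add: suminf_minus_initial_segment[OF pairing_summable[OF \<phi>]])
    then have "norm ((\<Sum>k<n. ?u k) - (\<Sum>k. ?u k)) = norm (\<Sum>k. ?u (k + n))"
      by simp
    also have "\<dots> \<le> (\<Sum>k. norm (?u (k + n)))"
      by (rule summable_norm[OF summ])
    also have "\<dots> \<le> C * D'"
    proof (rule suminf_le_const[OF summ])
      fix m
      have "(\<Sum>k<m. norm (?u (k + n))) = (\<Sum>k\<in>{n..<m + n}. norm (?u k))"
        using sum.shift_bounds_nat_ivl[of "\<lambda>k. norm (?u k)" 0 n m] by (simp add: atLeast0LessThan)
      also have "\<dots> \<le> C * D'"
        using M[OF n, of "m + n"] D' by (intro pairing_le \<phi>) auto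
      finally show "(\<Sum>k<m. norm (?u (k + n))) \<le> C * D'" .
    qed
    finally show "norm ((\<Sum>k<n. ?u k) - (\<Sum>k. ?u k)) \<le> e" using D' by simp
  qed
qed

end

lemma suminf_scaleC_right:
  fixes u :: "nat \<Rightarrow> 'f::complex_normed_vector"
  assumes "summable u"
  shows "(\<Sum>k. a *\<^sub>C u k) = a *\<^sub>C (\<Sum>k. u k)"
proof -
  have "bounded_linear (\<lambda>y::'f. a *\<^sub>C y)"
    using bounded_clinear_scaleC_right by (auto simp: bounded_clinear_def)
  from bounded_linear.suminf[OF this assms] show ?thesis by simp
qed

text \<open>
  The derived series converges uniformly near each point, because the scaled directional
  derivatives lie in the dual ball and convergence is uniform there. So the sum can be
  differentiated term by term.
\<close>

lemma dominated_series_in_Hinf: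
  fixes U :: "'e::complex_normed_vector set" and g :: "nat \<Rightarrow> 'e \<Rightarrow> complex"
    and y :: "nat \<Rightarrow> 'f::cbanach"
  assumes U: "open U" and ser: "dominated_series p (Hinf U) (sup_norm U) g C y D"
  shows "(\<lambda>x. \<Sum>n. g n x *\<^sub>C y n) \<in> Hinf U"
proof -
  interpret dominated_series p "Hinf U" "sup_norm U" g C y D by (rule ser)
  let ?f = "\<lambda>x. \<Sum>n. g n x *\<^sub>C y n"
  have g: "g n \<in> Hinf U" for n using dom by (auto simp: weakly_dominated_def)
  have sums: "(\<lambda>n. g n x *\<^sub>C y n) sums ?f x" for x
    using pairing_summable[OF evaluation_in_dual_ball] by (rule summable_sums)
  have "holomorphic_map U ?f"
    unfolding holomorphic_map_def
  proof
    fix x assume x: "x \<in> U"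
    obtain R where R: "0 < R" "cball x R \<subseteq> U"
      using U x open_contains_cball by blast
    define r where "r = R / 2"
    have r: "0 < r" using R by (simp add: r_def)
    have cb: "cball z r \<subseteq> U" if "z \<in> ball x r" for z
    proof -
      have "cball z r \<subseteq> cball x R"
      proof
        fix w assume "w \<in> cball z r"
        then show "w \<in> cball x R"
          using that dist_triangle[of x w z] by (simp add: r_def)
      qed
      then show ?thesis using R by blast
    qed
    define dg where "dg n z = frechet_derivative (g n) (at z)" for n z
    have dg: "(g n has_derivative dg n z) (at z)" "dg n z (a *\<^sub>C h) = a * dg n z h"
      if z: "z \<in> ball x r" for n z a h
    proof -
      have "z \<in> U" using cb[OF z] r by auto
      then obtain E where E: "bounded_clinear E" "(g n has_derivative E) (at z)"
        using Hinf_holomorphic[OF g] by (auto simp: holomorphic_map_def)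
      have "E = dg n z" unfolding dg_def by (rule frechet_derivative_at[OF E(2)])
      with E show "(g n has_derivative dg n z) (at z)" "dg n z (a *\<^sub>C h) = a * dg n z h"
        by (auto simp: bounded_clinear_def scaleC_complex_def)
    qed
    have dg_0: "dg n z 0 = 0" if "z \<in> ball x r" for n z
      by (rule linear_0[OF bounded_linear.linear[OF has_derivative_bounded_linear[OF dg(1)[OF that]]]])
    define f' where "f' z h = (\<Sum>n. dg n z h *\<^sub>C y n)" for z h
    \<comment> \<open>The factor \<open>r / norm h\<close> is the largest one that the Cauchy estimate on \<open>cball z r\<close> allows in the dual ball.\<close>
    define \<phi> :: "'e \<Rightarrow> 'e \<Rightarrow> ('e \<Rightarrow> complex) \<Rightarrow> complex"
      where "\<phi> z h = (\<lambda>u. of_real (r / norm h) * frechet_derivative u (at z) h)" for z h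
    have \<phi>: "\<phi> z h \<in> dual_ball_on (Hinf U) (sup_norm U)" if "z \<in> ball x r" "h \<noteq> 0" for z h
      unfolding \<phi>_def using that r cb[OF that(1)] by (intro derivative_in_dual_ball) auto
    have dg_\<phi>: "dg n z h *\<^sub>C y n = of_real (norm h / r) *\<^sub>C (\<phi> z h (g n) *\<^sub>C y n)"
      if "h \<noteq> 0" for n z h
      using that r by (simp add: \<phi>_def dg_def scaleC_scaleC)
    have bl: "bounded_linear (\<lambda>v::'f. a *\<^sub>C v)" for a
      using bounded_clinear_scaleC_right by (auto simp: bounded_clinear_def)
    have dg_summable: "summable (\<lambda>n. dg n z h *\<^sub>C y n)" if z: "z \<in> ball x r" for z h
    proof (cases "h = 0")
      case True
      then show ?thesis by (simp add: dg_0[OF z])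
    next
      case False
      then show ?thesis
        unfolding dg_\<phi>[OF False]
        by (intro bounded_linear.summable[OF bl] pairing_summable \<phi> z)
    qed
    have uniform: "\<forall>\<^sub>F n in sequentially. \<forall>z\<in>ball x r. \<forall>h.
        norm ((\<Sum>k<n. dg k z h *\<^sub>C y k) - f' z h) \<le> e * norm h" if e: "0 < e" for e
    proof -
      obtain M where M: "\<And>\<psi> n. \<psi> \<in> dual_ball_on (Hinf U) (sup_norm U) \<Longrightarrow> M \<le> n \<Longrightarrow>
          norm ((\<Sum>k<n. \<psi> (g k) *\<^sub>C y k) - (\<Sum>k. \<psi> (g k) *\<^sub>C y k)) \<le> e * r"
        using pairing_converges_uniformly[of "e * r", OF mult_pos_pos[OF e r]] by blast
      have "norm ((\<Sum>k<n. dg k z h *\<^sub>C y k) - f' z h) \<le> e * norm h"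
        if n: "M \<le> n" and z: "z \<in> ball x r" for n z h
      proof (cases "h = 0")
        case True
        then show ?thesis by (simp add: f'_def dg_0[OF z])
      next
        case False
        let ?u = "\<lambda>k. \<phi> z h (g k) *\<^sub>C y k"
        have "(\<Sum>k<n. dg k z h *\<^sub>C y k) - f' z h
            = of_real (norm h / r) *\<^sub>C ((\<Sum>k<n. ?u k) - (\<Sum>k. ?u k))"
          unfolding f'_def dg_\<phi>[OF False] suminf_scaleC_right[OF pairing_summable[OF \<phi>[OF z False]]]
          by (simp add: complex_vector.scale_sum_right complex_vector.scale_right_diff_distrib)
        then have "norm ((\<Sum>k<n. dg k z h *\<^sub>C y k) - f' z h)
            = norm h / r * norm ((\<Sum>k<n. ?u k) - (\<Sum>k. ?u k))"
          using r by (simp add: norm_scaleC norm_divide)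
        also have "\<dots> \<le> norm h / r * (e * r)"
          using M[OF \<phi>[OF z False] n] r by (intro mult_left_mono) auto
        finally show ?thesis using r by (simp add: mult.commute)
      qed
      then show ?thesis unfolding eventually_sequentially by blast
    qed
    have "\<exists>F. \<forall>z\<in>ball x r. (\<lambda>n. g n z *\<^sub>C y n) sums F z \<and> (F has_derivative f' z) (at z within ball x r)"
    proof (rule has_derivative_series[OF convex_ball _ uniform _ sums])
      show "((\<lambda>z. g n z *\<^sub>C y n) has_derivative (\<lambda>h. dg n z h *\<^sub>C y n)) (at z within ball x r)"
        if "z \<in> ball x r" for n z
        using bounded_linear.has_derivative[OF bounded_linear_scaleC_left dg(1)[OF that]]
        by (rule has_derivative_at_withinI)
      show "x \<in> ball x r" using r by simp
    qed
    then obtain F where F: "\<And>z. z \<in> ball x r \<Longrightarrow> (\<lambda>n. g n z *\<^sub>C y n) sums F z"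
      and F': "(F has_derivative f' x) (at x within ball x r)"
      using r by (meson centre_in_ball)
    have xr: "x \<in> ball x r" using r by simp
    have "(F has_derivative f' x) (at x)"
      using F' at_within_open[OF xr open_ball] by simp
    then have der: "(?f has_derivative f' x) (at x)"
      by (rule has_derivative_transform_within_open[OF _ open_ball xr])
         (use F in \<open>simp add: sums_iff\<close>)
    have "f' x (a *\<^sub>C h) = a *\<^sub>C f' x h" for a h
      unfolding f'_def dg(2)[OF xr] scaleC_scaleC[symmetric]
      by (rule suminf_scaleC_right[OF dg_summable[OF xr]])
    then have "bounded_clinear (f' x)"
      using der by (simp add: bounded_clinear_def has_derivative_bounded_linear)
    with der show "\<exists>D. bounded_clinear D \<and> (?f has_derivative D) (at x)" by blast
  qed
  then show ?thesis
  proof (rule HinfI)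
    show "norm (?f x) \<le> C * D" for x
      by (rule norm_pairing_le[OF evaluation_in_dual_ball])
    show "?f x = 0" if "x \<notin> U" for x
      using Hinf_zero[OF g that] by simp
  qed
qed

section \<open>Representations of nuclear mappings\<close>

text \<open>
  A nuclear representation with explicit bounds and merely pointwise convergence. By
  \<open>dominated_repr_imp_right_nuclear\<close> and \<open>nuclear_repr_imp_dominated\<close> on an open set such representations exist for
  exactly the right nuclear mappings, although those ask for convergence in the supremum norm.
\<close>

definition dominated_repr ::
    "real \<Rightarrow> 'e::complex_normed_vector set \<Rightarrow> ('e \<Rightarrow> 'f::cbanach) \<Rightarrow>
      (nat \<Rightarrow> 'e \<Rightarrow> complex) \<Rightarrow> (nat \<Rightarrow> 'f) \<Rightarrow> real \<Rightarrow> real \<Rightarrow> bool"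
  where "dominated_repr p U f g y C D \<longleftrightarrow>
    dominated_series p (Hinf U) (sup_norm U) g C y D \<and> (\<forall>x. (\<lambda>n. g n x *\<^sub>C y n) sums f x)"

lemma partial_sum_apply:
  fixes k :: nat
  shows "(\<Sum>n<k. g n \<odot> y n) x = (\<Sum>n<k. g n x *\<^sub>C y n)"
  by (induction k) (simp_all add: rank_one_def)

text \<open>
  Pointwise convergence upgrades itself to convergence in the supremum norm, since the
  point evaluations all lie in the dual ball, where the series converges uniformly.
\<close>

lemma dominated_repr_imp_right_nuclear:
  fixes f :: "'e::complex_normed_vector \<Rightarrow> 'f::cbanach"
  assumes U: "open U" and repr: "dominated_repr p U f g y C D"
  shows "f \<in> right_nuclear p U" and "right_nuclear_norm p U f \<le> C * D"
proof -
  interpret dominated_series p "Hinf U" "sup_norm U" g C y D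
    using repr by (simp add: dominated_repr_def)
  have f: "f = (\<lambda>x. \<Sum>n. g n x *\<^sub>C y n)"
    using repr by (auto simp: dominated_repr_def sums_iff fun_eq_iff)
  have fH: "f \<in> Hinf U"
    unfolding f using dominated_series_in_Hinf[OF U] dominated_series_axioms .
  have weak: "g \<in> weak_lq_seqs (conj_exponent p) (Hinf U) (sup_norm U)"
    "weak_lq_norm (conj_exponent p) (Hinf U) (sup_norm U) g \<le> C"
    using weakly_dominated_imp_weak_lq[OF p sup_norm_nonneg C dom] by auto
  have conv: "(\<lambda>k. sup_norm U (f - (\<Sum>n<k. g n \<odot> y n))) \<longlonglongrightarrow> 0"
  proof (rule tendstoI)
    fix e :: real assume e: "0 < e"
    obtain M where M: "\<And>\<psi> n. \<psi> \<in> dual_ball_on (Hinf U) (sup_norm U) \<Longrightarrow> M \<le> n \<Longrightarrow>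
        norm ((\<Sum>k<n. \<psi> (g k) *\<^sub>C y k) - (\<Sum>k. \<psi> (g k) *\<^sub>C y k)) \<le> e / 2"
      using pairing_converges_uniformly[of "e / 2", OF half_gt_zero[OF e]] by blast
    have "dist (sup_norm U (f - (\<Sum>n<k. g n \<odot> y n))) 0 < e" if k: "M \<le> k" for k
    proof -
      have "norm ((f - (\<Sum>n<k. g n \<odot> y n)) x) \<le> e / 2" for x
        using M[OF evaluation_in_dual_ball k, of x]
        by (simp add: f partial_sum_apply norm_minus_commute)
      then have "sup_norm U (f - (\<Sum>n<k. g n \<odot> y n)) \<le> e / 2"
        using e by (intro sup_norm_le) auto
      moreover have "0 \<le> sup_norm U (f - (\<Sum>n<k. g n \<odot> y n))"
        using dom fH
        by (intro sup_norm_nonneg complex_vector.subspace_diff complex_vector.subspace_sum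
            subspace_Hinf rank_one_in_Hinf) (auto simp: weakly_dominated_def)
      ultimately show ?thesis using e by (simp add: dist_real_def)
    qed
    then show "\<forall>\<^sub>F k in sequentially. dist (sup_norm U (f - (\<Sum>n<k. g n \<odot> y n))) 0 < e"
      unfolding eventually_sequentially by blast
  qed
  have nrepr: "nuclear_repr p U f g y"
    using weak(1) conv lp_summable by (simp add: nuclear_repr_def lp_seqs_def)
  then show "f \<in> right_nuclear p U"
    using fH by (auto simp: right_nuclear_def)
  have "lp_norm p y \<le> (D powr p) powr (1 / p)"
    unfolding lp_norm_def using p lp_summable y
    by (intro powr_mono2 suminf_le_const suminf_nonneg) auto
  then have lp: "lp_norm p y \<le> D"
    using p D by (simp add: powr_powr)
  have "right_nuclear_norm p U f \<le> weak_lq_norm (conj_exponent p) (Hinf U) (sup_norm U) g * lp_norm p y"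
    unfolding right_nuclear_norm_def
  proof (rule cInf_lower)
    show "bdd_below {weak_lq_norm (conj_exponent p) (Hinf U) (sup_norm U) g * lp_norm p y |g y.
      nuclear_repr p U f g y}"
      by (intro bdd_belowI[of _ 0])
         (auto simp: nuclear_repr_def lp_norm_def
           intro!: mult_nonneg_nonneg weakly_dominated_weak_lq_norm(2)[OF p subspace_Hinf] sup_norm_nonneg)
  qed (use nrepr in blast)
  also have "\<dots> \<le> C * D"
    using weak(2) lp C by (intro mult_mono) (auto simp: lp_norm_def)
  finally show "right_nuclear_norm p U f \<le> C * D" .
qed

lemma weakly_dominated_mono:
  assumes "1 \<le> p" "0 \<le> C" "C \<le> C'" "weakly_dominated p X N x C"
  shows "weakly_dominated p X N x C'"
proof (cases "p = 1")
  case True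
  then show ?thesis using assms by (auto simp: weakly_dominated_def intro: order_trans)
next
  case False
  have "C powr (p / (p - 1)) \<le> C' powr (p / (p - 1))"
    using assms by (intro powr_mono2) auto
  then show ?thesis
    using assms False by (auto simp: weakly_dominated_def intro: order_trans)
qed

lemma powr_conjugate_mult:
  fixes b :: real
  assumes "0 \<le> b"
  shows "b powr (1 - 1 / p) * b powr (1 / p) = b"
  using assms by (simp flip: powr_add)

lemma dominated_repr_mono:
  assumes "dominated_repr p U f g y C D" "C \<le> C'" "D \<le> D'"
  shows "dominated_repr p U f g y C' D'"
proof -
  interpret dominated_series p "Hinf U" "sup_norm U" g C y D
    using assms by (simp add: dominated_repr_def)
  have "D powr p \<le> D' powr p"
    using D p assms by (intro powr_mono2) auto
  then have "dominated_series p (Hinf U) (sup_norm U) g C' y D'"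
    using p C D assms y weakly_dominated_mono[OF p C _ dom]
    by unfold_locales (auto intro: order_trans)
  then show ?thesis using assms by (simp add: dominated_repr_def)
qed

lemma dominated_repr_scale:
  assumes repr: "dominated_repr p U f g y C D" and t: "0 < t"
  shows "dominated_repr p U f (\<lambda>n. of_real t *\<^sub>C g n) (\<lambda>n. of_real (1 / t) *\<^sub>C y n) (t * C) (D / t)"
proof -
  interpret dominated_series p "Hinf U" "sup_norm U" g C y D
    using repr by (simp add: dominated_repr_def)
  have "weakly_dominated p (Hinf U) (sup_norm U) (\<lambda>n. of_real t *\<^sub>C g n) (t * C)"
    using weakly_dominated_scale[OF subspace_Hinf norm_on_Hinf C dom, of "of_real t"] t by simp
  moreover have "(\<Sum>k<n. norm (of_real (1 / t) *\<^sub>C y k) powr p) \<le> (D / t) powr p" for n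
  proof -
    have "(\<Sum>k<n. norm (of_real (1 / t) *\<^sub>C y k) powr p) = (\<Sum>k<n. norm (y k) powr p) / t powr p"
      using t by (simp add: norm_scaleC norm_divide powr_divide sum_divide_distrib)
    also have "\<dots> \<le> D powr p / t powr p"
      using y by (intro divide_right_mono) auto
    finally show ?thesis using t D by (simp add: powr_divide)
  qed
  ultimately have "dominated_series p (Hinf U) (sup_norm U)
      (\<lambda>n. of_real t *\<^sub>C g n) (t * C) (\<lambda>n. of_real (1 / t) *\<^sub>C y n) (D / t)"
    using p C D t by unfold_locales auto
  moreover have "(of_real t *\<^sub>C g n) x *\<^sub>C (of_real (1 / t) *\<^sub>C y n) = g n x *\<^sub>C y n" for n x
    using t by (simp add: scaleC_fun_def scaleC_complex_def scaleC_scaleC)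
  ultimately show ?thesis using repr by (simp only: dominated_repr_def simp_thms)
qed

text \<open>
  Moving a positive factor from \<open>y\<close> to \<open>g\<close> distributes the product \<open>C * D\<close> in the proportion that
  makes \<open>b\<close> a bound for both the sum of \<open>q\<close>-th powers and the sum of \<open>p\<close>-th powers, \<open>q\<close> conjugate
  to \<open>p\<close>; for \<open>p = 1\<close> the former is a bound \<open>1\<close> for the members of \<open>g\<close>. In this shape representations can be interleaved and their bounds add up.
\<close>

lemma dominated_repr_normalise:
  assumes repr: "dominated_repr p U f g y C D" and b: "0 < b" "C * D \<le> b"
  shows "\<exists>g y. dominated_repr p U f g y (b powr (1 - 1 / p)) (b powr (1 / p))"
proof -
  interpret dominated_series p "Hinf U" "sup_norm U" g C y D
    using repr by (simp add: dominated_repr_def)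
  have pos: "0 < b powr (1 - 1 / p)" "0 < b powr (1 / p)" using b by auto
  have "\<exists>t>0. t * C \<le> b powr (1 - 1 / p) \<and> D / t \<le> b powr (1 / p)"
  proof (cases "C = 0")
    case True
    have "D / b powr (1 / p) + 1 > 0" "D \<le> b powr (1 / p) * (D / b powr (1 / p) + 1)"
      using D pos by (auto simp: field_simps intro: add_nonneg_pos)
    \<comment> \<open>Here only the second inequality restricts \<open>t\<close>; the summand \<open>1\<close> makes \<open>t\<close> positive when \<open>D = 0\<close>.\<close>
    with True pos show ?thesis
      by (intro exI[of _ "D / b powr (1 / p) + 1"]) (auto simp: divide_le_eq)
  next
    case False
    with C have C': "0 < C" by simp
    have "D * C \<le> b powr (1 / p) * b powr (1 - 1 / p)"
      using b powr_conjugate_mult[of b p] by (simp add: mult.commute)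
    with C' pos show ?thesis
      by (intro exI[of _ "b powr (1 - 1 / p) / C"]) (auto simp: field_simps)
  qed
  then show ?thesis
    using dominated_repr_mono[OF dominated_repr_scale[OF repr]] by blast
qed

lemma nuclear_repr_imp_dominated:
  fixes f :: "'e::complex_normed_vector \<Rightarrow> 'f::cbanach"
  assumes p: "1 \<le> p" and f: "f \<in> Hinf U" and repr: "nuclear_repr p U f g y"
  shows "dominated_repr p U f g y (weak_lq_norm (conj_exponent p) (Hinf U) (sup_norm U) g) (lp_norm p y)"
proof -
  have weak: "g \<in> weak_lq_seqs (conj_exponent p) (Hinf U) (sup_norm U)"
    and summ: "summable (\<lambda>n. norm (y n) powr p)"
    and conv: "(\<lambda>k. sup_norm U (f - (\<Sum>n<k. g n \<odot> y n))) \<longlonglongrightarrow> 0"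
    using repr by (auto simp: nuclear_repr_def lp_seqs_def)
  have g: "g n \<in> Hinf U" for n using weak by (auto simp: weak_lq_seqs_def)
  have "lp_norm p y powr p = (\<Sum>n. norm (y n) powr p)"
    using p summ by (simp add: lp_norm_def powr_powr suminf_nonneg)
  moreover have "(\<Sum>k<n. norm (y k) powr p) \<le> (\<Sum>n. norm (y n) powr p)" for n
    by (rule sum_le_suminf[OF summ]) auto
  ultimately have "dominated_series p (Hinf U) (sup_norm U) g
      (weak_lq_norm (conj_exponent p) (Hinf U) (sup_norm U) g) y (lp_norm p y)"
    using weakly_dominated_weak_lq_norm[where X = "Hinf U" and N = "sup_norm U",
        OF p subspace_Hinf sup_norm_nonneg weak] p
    by unfold_locales (auto simp: lp_norm_def)
  moreover have "(\<lambda>n. g n x *\<^sub>C y n) sums f x" for x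
  proof -
    have "norm ((f - (\<Sum>n<k. g n \<odot> y n)) x) \<le> sup_norm U (f - (\<Sum>n<k. g n \<odot> y n))" for k
      by (intro norm_le_sup_norm complex_vector.subspace_diff complex_vector.subspace_sum
          subspace_Hinf rank_one_in_Hinf f g)
    then have "(\<lambda>k. f x - (\<Sum>n<k. g n x *\<^sub>C y n)) \<longlonglongrightarrow> 0"
      by (intro Lim_null_comparison[OF always_eventually conv]) (simp add: partial_sum_apply)
    from tendsto_diff[OF tendsto_const[of "f x"] this] show ?thesis
      by (simp add: sums_def)
  qed
  ultimately show ?thesis by (simp add: dominated_repr_def)
qed

lemma right_nuclear_norm_nonneg:
  fixes f :: "'e::complex_normed_vector \<Rightarrow> 'f::cbanach"
  assumes p: "1 \<le> p" and f: "f \<in> right_nuclear p U"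
  shows "0 \<le> right_nuclear_norm p U f"
  unfolding right_nuclear_norm_def
proof (rule cInf_greatest)
  show "{weak_lq_norm (conj_exponent p) (Hinf U) (sup_norm U) g * lp_norm p y |g y.
      nuclear_repr p U f g y} \<noteq> {}"
    using f by (auto simp: right_nuclear_def)
next
  fix c assume "c \<in> {weak_lq_norm (conj_exponent p) (Hinf U) (sup_norm U) g * lp_norm p y |g y.
      nuclear_repr p U f g y}"
  then obtain g y where c: "c = weak_lq_norm (conj_exponent p) (Hinf U) (sup_norm U) g * lp_norm p y"
    and "nuclear_repr p U f g y" by blast
  then have "dominated_repr p U f g y (weak_lq_norm (conj_exponent p) (Hinf U) (sup_norm U) g) (lp_norm p y)"
    using nuclear_repr_imp_dominated[OF p] f by (auto simp: right_nuclear_def)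
  then show "0 \<le> c"
    by (auto simp: c dominated_repr_def dominated_series_def)
qed

text \<open>
  The infimum need not be attained, so arguments about the norm start from an arbitrary \<open>b\<close> above it.
\<close>

lemma right_nuclear_norm_less_imp_repr:
  fixes f :: "'e::complex_normed_vector \<Rightarrow> 'f::cbanach"
  assumes p: "1 \<le> p" and f: "f \<in> right_nuclear p U" and b: "right_nuclear_norm p U f < b"
  obtains g y where "dominated_repr p U f g y (b powr (1 - 1 / p)) (b powr (1 / p))"
proof -
  have "{weak_lq_norm (conj_exponent p) (Hinf U) (sup_norm U) g * lp_norm p y |g y.
      nuclear_repr p U f g y} \<noteq> {}"
    using f by (auto simp: right_nuclear_def)
  from cInf_lessD[OF this b[unfolded right_nuclear_norm_def]]
  obtain g y where "nuclear_repr p U f g y"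
    and "weak_lq_norm (conj_exponent p) (Hinf U) (sup_norm U) g * lp_norm p y < b"
    by blast
  moreover have "0 < b" using right_nuclear_norm_nonneg[OF p f] b by simp
  moreover have "f \<in> Hinf U" using f by (simp add: right_nuclear_def)
  ultimately show ?thesis
    using dominated_repr_normalise[OF nuclear_repr_imp_dominated[OF p], of f U g y b] that
    by (auto simp: less_imp_le)
qed

text \<open>
  Pair a representation with the evaluation functionals.
\<close>

lemma sup_norm_le_right_nuclear_norm:
  fixes f :: "'e::complex_normed_vector \<Rightarrow> 'f::cbanach"
  assumes p: "1 \<le> p" and f: "f \<in> right_nuclear p U"
  shows "sup_norm U f \<le> right_nuclear_norm p U f"
proof (rule dense_ge)
  fix b assume b: "right_nuclear_norm p U f < b"
  then have b0: "0 < b" using right_nuclear_norm_nonneg[OF p f] by simp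
  obtain g y where repr: "dominated_repr p U f g y (b powr (1 - 1 / p)) (b powr (1 / p))"
    using right_nuclear_norm_less_imp_repr[OF p f b] .
  interpret dominated_series p "Hinf U" "sup_norm U" g "b powr (1 - 1 / p)" y "b powr (1 / p)"
    using repr by (simp add: dominated_repr_def)
  have "norm (f x) \<le> b" for x
    using norm_pairing_le[OF evaluation_in_dual_ball, of x] repr b0
    by (simp add: dominated_repr_def sums_iff powr_conjugate_mult)
  then show "sup_norm U f \<le> b" using b0 by (intro sup_norm_le) auto
qed

section \<open>Countable subadditivity of the nuclear norm\<close>

text \<open>
  Countable subadditivity, from which both the triangle inequality and completeness follow.
  Normalised representations of the \<open>f j\<close> are interleaved along an enumeration of the pairs
  of indices; the weak and strong bounds of the rows add up to those of the whole. The resulting series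
  converges absolutely at each point, so it may be summed row by row.
\<close>

lemma right_nuclear_suminf:
  fixes f :: "nat \<Rightarrow> 'e::complex_normed_vector \<Rightarrow> 'f::cbanach"
  assumes p: "1 \<le> p" and U: "open U" and f: "\<And>j. f j \<in> right_nuclear p U"
    and less: "\<And>j. right_nuclear_norm p U (f j) < b j" and summ: "summable b"
  obtains F where "F \<in> right_nuclear p U" "right_nuclear_norm p U F \<le> suminf b"
    "\<And>x. (\<lambda>j. f j x) sums F x"
proof -
  have b: "0 < b j" for j
    using right_nuclear_norm_nonneg[OF p f] less by (rule le_less_trans)
  have B: "0 < suminf b" using b summ by (simp add: suminf_pos)
  have "\<forall>j. \<exists>g y. dominated_repr p U (f j) g y (b j powr (1 - 1 / p)) (b j powr (1 / p))"
    using right_nuclear_norm_less_imp_repr[OF p f less] by metis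
  then obtain g y where
    repr: "\<And>j. dominated_repr p U (f j) (g j) (y j) (b j powr (1 - 1 / p)) (b j powr (1 / p))"
    by metis
  have ser: "dominated_series p (Hinf U) (sup_norm U) (g j) (b j powr (1 - 1 / p)) (y j) (b j powr (1 / p))" for j
    using repr[of j] by (simp add: dominated_repr_def)
  define G where "G n = (case prod_decode n of (j, i) \<Rightarrow> g j i)" for n
  define Y where "Y n = (case prod_decode n of (j, i) \<Rightarrow> y j i)" for n
  have powr_p: "(c powr (1 / p)) powr p = c" if "0 < c" for c :: real
    using p that by (simp add: powr_powr)
  interpret S: dominated_series p "Hinf U" "sup_norm U" G "suminf b powr (1 - 1 / p)" Y "suminf b powr (1 / p)"
  proof
    show "weakly_dominated p (Hinf U) (sup_norm U) G (suminf b powr (1 - 1 / p))"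
      unfolding G_def using dominated_series.dom[OF ser] by (intro weakly_dominated_interleave p b summ)
    show "(\<Sum>k<n. norm (Y k) powr p) \<le> (suminf b powr (1 / p)) powr p" for n
    proof -
      have "(\<Sum>i<n. norm (y j i) powr p) \<le> b j" for j n
        using dominated_series.y[OF ser, of j n] by (simp add: powr_p b)
      then have "(\<Sum>k<n. case prod_decode k of (j, i) \<Rightarrow> norm (y j i) powr p) \<le> suminf b"
        by (intro sum_prod_decode_le summ) auto
      then show ?thesis by (simp add: Y_def case_prod_unfold powr_p B)
    qed
  qed (use p in auto)
  define F where "F x = (\<Sum>n. G n x *\<^sub>C Y n)" for x
  have Fsums: "(\<lambda>n. G n x *\<^sub>C Y n) sums F x" for x
    unfolding F_def by (intro summable_sums S.pairing_summable evaluation_in_dual_ball)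
  have "dominated_repr p U F G Y (suminf b powr (1 - 1 / p)) (suminf b powr (1 / p))"
    using S.dominated_series_axioms Fsums by (simp add: dominated_repr_def)
  note nuc = dominated_repr_imp_right_nuclear[OF U this]
  have "(\<lambda>j. f j x) sums F x" for x
  proof (rule has_sum_imp_sums)
    define u where "u = (\<lambda>(j, i). g j i x *\<^sub>C y j i)"
    have "((\<lambda>n. G n x *\<^sub>C Y n) has_sum F x) UNIV"
      by (intro norm_summable_imp_has_sum S.pairing_abs_summable evaluation_in_dual_ball Fsums)
    moreover have "(\<lambda>n. G n x *\<^sub>C Y n) = u \<circ> prod_decode"
      by (auto simp: u_def G_def Y_def fun_eq_iff split: prod.split)
    ultimately have "(u has_sum F x) (range prod_decode)"
      by (simp add: has_sum_reindex[OF inj_prod_decode])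
    then have tot: "(u has_sum F x) (Sigma UNIV (\<lambda>_. UNIV))"
      by (simp add: surj_prod_decode)
    have "((\<lambda>i. u (j, i)) has_sum f j x) UNIV" for j
    proof -
      have "(\<lambda>i. g j i x *\<^sub>C y j i) sums f j x"
        using repr[of j] by (simp add: dominated_repr_def)
      moreover have "summable (\<lambda>i. norm (g j i x *\<^sub>C y j i))"
        by (rule dominated_series.pairing_abs_summable[OF ser evaluation_in_dual_ball])
      ultimately show ?thesis
        using norm_summable_imp_has_sum by (simp add: u_def)
    qed
    then show "((\<lambda>j. f j x) has_sum F x) UNIV"
      by (intro has_sum_SigmaD[OF tot])
  qed
  then show ?thesis
    using nuc B by (intro that) (auto simp: powr_conjugate_mult)
qed

section \<open>Composition, elementary mappings and the norm axioms\<close>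

lemma le_mult_if_le_mult_greater:
  fixes a K x :: real
  assumes le: "\<And>b. a < b \<Longrightarrow> x \<le> K * b" and K: "0 \<le> K"
  shows "x \<le> K * a"
proof (rule field_le_epsilon)
  fix e :: real assume e: "0 < e"
  have "x \<le> K * (a + e / (K + 1))" using e K by (intro le) auto
  also have "\<dots> \<le> K * a + e" using e K by (simp add: field_simps)
  finally show "x \<le> K * a + e" .
qed

text \<open>
  Compose a representation term by term: \<open>u \<mapsto> u \<circ> h\<close> is a contraction of the scalar spaces, and \<open>S\<close>
  increases the \<open>p\<close>-norm of \<open>y\<close> at most by its operator norm.
\<close>

lemma right_nuclear_compose:
  fixes f :: "'e::complex_normed_vector \<Rightarrow> 'f::cbanach" and S :: "'f \<Rightarrow> 'g::cbanach"
    and h :: "'h::complex_normed_vector \<Rightarrow> 'e"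
  assumes p: "1 \<le> p" and V: "open V" and h: "holomorphic_map V h" "h ` V \<subseteq> U"
    and f: "f \<in> right_nuclear p U" and S: "bounded_clinear S"
  shows "zero_extend V (S \<circ> f \<circ> h) \<in> right_nuclear p V"
    and "right_nuclear_norm p V (zero_extend V (S \<circ> f \<circ> h)) \<le> onorm S * right_nuclear_norm p U f"
proof -
  let ?F = "zero_extend V (S \<circ> f \<circ> h)"
  have bl: "bounded_linear S" and S_scale: "\<And>a v. S (a *\<^sub>C v) = a *\<^sub>C S v"
    using S by (auto simp: bounded_clinear_def)
  have main: "?F \<in> right_nuclear p V \<and> right_nuclear_norm p V ?F \<le> onorm S * b"
    if b: "right_nuclear_norm p U f < b" for b
  proof -
    have b0: "0 < b" using right_nuclear_norm_nonneg[OF p f] b by simp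
    obtain g y where repr: "dominated_repr p U f g y (b powr (1 - 1 / p)) (b powr (1 / p))"
      using right_nuclear_norm_less_imp_repr[OF p f b] .
    interpret dominated_series p "Hinf U" "sup_norm U" g "b powr (1 - 1 / p)" y "b powr (1 / p)"
      using repr by (simp add: dominated_repr_def)
    let ?T = "\<lambda>u :: 'e \<Rightarrow> complex. zero_extend V (u \<circ> h)"
    have T_le: "sup_norm V (?T u) \<le> sup_norm U u" if "u \<in> Hinf U" for u
      using norm_le_sup_norm[OF that] sup_norm_nonneg[OF that]
      by (intro sup_norm_le) (auto simp: zero_extend_def)
    have T_in: "?T u \<in> Hinf V" if "u \<in> Hinf U" for u
      using that by (rule zero_extend_comp_in_Hinf[OF V h])
    have T_lin: "?T (u + v) = ?T u + ?T v" "?T (a *\<^sub>C u) = a *\<^sub>C ?T u" for u v a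
      by (auto simp: zero_extend_def fun_eq_iff scaleC_fun_def scaleC_complex_def)
    have dual: "(\<lambda>u. \<phi> (?T u)) \<in> dual_ball_on (Hinf U) (sup_norm U)"
      if "\<phi> \<in> dual_ball_on (Hinf V) (sup_norm V)" for \<phi>
      using that T_in order_trans[OF _ T_le]
      by (auto simp: dual_ball_on_def clinear_functional_on_def T_lin)
    have "dominated_series p (Hinf V) (sup_norm V) (\<lambda>n. ?T (g n)) (b powr (1 - 1 / p))
        (\<lambda>n. S (y n)) (onorm S * b powr (1 / p))"
    proof
      show "weakly_dominated p (Hinf V) (sup_norm V) (\<lambda>n. ?T (g n)) (b powr (1 - 1 / p))"
        by (rule weakly_dominated_map[where T = ?T, OF dom T_in T_le dual])
      show "(\<Sum>k<n. norm (S (y k)) powr p) \<le> (onorm S * b powr (1 / p)) powr p" for n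
      proof -
        have "norm (S (y k)) powr p \<le> onorm S powr p * norm (y k) powr p" for k
          using p onorm[OF bl, of "y k"] onorm_pos_le[OF bl]
          by (simp add: powr_mono2 flip: powr_mult)
        then have "(\<Sum>k<n. norm (S (y k)) powr p) \<le> onorm S powr p * (\<Sum>k<n. norm (y k) powr p)"
          by (simp add: sum_distrib_left sum_mono)
        also have "\<dots> \<le> onorm S powr p * (b powr (1 / p)) powr p"
          using y by (intro mult_left_mono) auto
        finally show ?thesis
          using onorm_pos_le[OF bl] by (simp add: powr_mult)
      qed
    qed (use p onorm_pos_le[OF bl] in auto)
    moreover have "(\<lambda>n. ?T (g n) x *\<^sub>C S (y n)) sums ?F x" for x
    proof (cases "x \<in> V")
      case True
      have "(\<lambda>n. g n (h x) *\<^sub>C y n) sums f (h x)"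
        using repr by (simp add: dominated_repr_def)
      from bounded_linear.sums[OF bl this] True show ?thesis
        by (simp add: zero_extend_def S_scale)
    qed (simp add: zero_extend_def)
    ultimately have "dominated_repr p V ?F (\<lambda>n. ?T (g n)) (\<lambda>n. S (y n))
        (b powr (1 - 1 / p)) (onorm S * b powr (1 / p))"
      by (simp add: dominated_repr_def)
    note nuc = dominated_repr_imp_right_nuclear[OF V this]
    have "b powr (1 - 1 / p) * (onorm S * b powr (1 / p)) = onorm S * b"
      using powr_conjugate_mult[of b p] b0 by (metis less_imp_le mult.left_commute)
    with nuc show ?thesis by simp
  qed
  show "?F \<in> right_nuclear p V"
    using main[of "right_nuclear_norm p U f + 1"] by simp
  show "right_nuclear_norm p V ?F \<le> onorm S * right_nuclear_norm p U f"
    by (rule le_mult_if_le_mult_greater[OF _ onorm_pos_le[OF bl]]) (simp add: main)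
qed

text \<open>
  The one-term representation bounds the norm from above, the supremum norm bounds it from below.
\<close>

lemma rank_one_right_nuclear:
  fixes g :: "'e::complex_normed_vector \<Rightarrow> complex" and y :: "'f::cbanach"
  assumes p: "1 \<le> p" and U: "open U" and g: "g \<in> Hinf U"
  shows "g \<odot> y \<in> right_nuclear p U" and "right_nuclear_norm p U (g \<odot> y) = sup_norm U g * norm y"
proof -
  let ?G = "\<lambda>n::nat. if n = 0 then g else 0" and ?Y = "\<lambda>n::nat. if n = 0 then y else 0"
  have G: "?G n \<in> Hinf U" for n
    using g complex_vector.subspace_0[OF subspace_Hinf] by auto
  then have G_range: "range ?G \<subseteq> Hinf U" by blast
  have single: "(\<Sum>k<n. if k = 0 then c else 0) \<le> c" if "0 \<le> c" for c :: real and n :: nat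
    using that by (cases n) (auto simp: sum.delta)
  have "weakly_dominated p (Hinf U) (sup_norm U) ?G (sup_norm U g)"
  proof (cases "p = 1")
    case True
    have "sup_norm U (0 :: 'e \<Rightarrow> complex) = 0" by (simp add: sup_norm_def)
    then have "sup_norm U (?G n) \<le> sup_norm U g" for n
      using sup_norm_nonneg[OF g] by simp
    with True G_range show ?thesis by (simp only: weakly_dominated_def if_True simp_thms)
  next
    case False
    let ?q = "p / (p - 1)"
    have "(\<Sum>k<n. cmod (\<phi> (?G k)) powr ?q) \<le> sup_norm U g powr ?q"
      if \<phi>: "\<phi> \<in> dual_ball_on (Hinf U) (sup_norm U)" for \<phi> n
    proof -
      have "\<phi> (0 *\<^sub>C g) = 0 * \<phi> g"
        by (rule clinear_functional_on_scale[OF _ g]) (use \<phi> in \<open>simp add: dual_ball_on_def\<close>)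
      then have "cmod (\<phi> (?G k)) powr ?q = (if k = 0 then cmod (\<phi> g) powr ?q else 0)" for k
        using p by simp
      then have "(\<Sum>k<n. cmod (\<phi> (?G k)) powr ?q) \<le> cmod (\<phi> g) powr ?q"
        using single by simp
      also have "\<dots> \<le> sup_norm U g powr ?q"
        using \<phi> g p by (intro powr_mono2) (auto simp: dual_ball_on_def)
      finally show ?thesis .
    qed
    with False G_range show ?thesis by (simp only: weakly_dominated_def if_False simp_thms) blast
  qed
  moreover have "(\<Sum>k<n. norm (?Y k) powr p) \<le> norm y powr p" for n
  proof -
    have "norm (?Y k) powr p = (if k = 0 then norm y powr p else 0)" for k using p by simp
    then show ?thesis using single by simp
  qed
  ultimately have "dominated_series p (Hinf U) (sup_norm U) ?G (sup_norm U g) ?Y (norm y)"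
    using p sup_norm_nonneg[OF g] by unfold_locales auto
  moreover have "(\<lambda>n. ?G n x *\<^sub>C ?Y n) sums (g \<odot> y) x" for x
  proof -
    have "(\<lambda>n. ?G n x *\<^sub>C ?Y n) = (\<lambda>n. if n = 0 then g x *\<^sub>C y else 0)"
      by (rule ext) simp
    with sums_single[of 0 "\<lambda>_. g x *\<^sub>C y"] show ?thesis by (simp only: rank_one_def)
  qed
  ultimately have "dominated_repr p U (g \<odot> y) ?G ?Y (sup_norm U g) (norm y)"
    by (simp add: dominated_repr_def)
  note nuc = dominated_repr_imp_right_nuclear[OF U this]
  show mem: "g \<odot> y \<in> right_nuclear p U" by (rule nuc)
  have "sup_norm U g * norm y \<le> sup_norm U (g \<odot> y)"
  proof (cases "U = {} \<or> y = 0")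
    case True
    then show ?thesis
      using sup_norm_nonneg[OF rank_one_in_Hinf[OF g], of y] by (auto simp: sup_norm_def[of "{}"])
  next
    case False
    have "norm (g x) * norm y \<le> sup_norm U (g \<odot> y)" for x
      using norm_le_sup_norm[OF rank_one_in_Hinf[OF g], of y x] by (simp add: rank_one_def norm_scaleC)
    then have "sup_norm U g \<le> sup_norm U (g \<odot> y) / norm y"
      using False sup_norm_nonneg[OF rank_one_in_Hinf[OF g], of y]
      by (intro sup_norm_le) (auto simp: field_simps)
    then show ?thesis using False by (simp add: field_simps)
  qed
  also have "\<dots> \<le> right_nuclear_norm p U (g \<odot> y)"
    by (rule sup_norm_le_right_nuclear_norm[OF p mem])
  finally show "right_nuclear_norm p U (g \<odot> y) = sup_norm U g * norm y"
    using nuc(2) by simp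
qed

text \<open>
  Multiplication by \<open>a\<close> is composition with a linear operator of norm at most \<open>|a|\<close>.
\<close>

lemma right_nuclear_scale:
  fixes f :: "'e::complex_normed_vector \<Rightarrow> 'f::cbanach"
  assumes p: "1 \<le> p" and U: "open U" and f: "f \<in> right_nuclear p U"
  shows "a *\<^sub>C f \<in> right_nuclear p U"
    and "right_nuclear_norm p U (a *\<^sub>C f) \<le> cmod a * right_nuclear_norm p U f"
proof -
  have id: "holomorphic_map U (\<lambda>x::'e. x)"
    unfolding holomorphic_map_def
    by (intro ballI exI[of _ "\<lambda>h. h"]) (auto simp: bounded_clinear_def)
  have eq: "zero_extend U ((\<lambda>v. a *\<^sub>C v) \<circ> f \<circ> (\<lambda>x. x)) = a *\<^sub>C f"
    using f by (auto simp: zero_extend_def scaleC_fun_def fun_eq_iff right_nuclear_def Hinf_zero)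
  note comp = right_nuclear_compose[OF p U id _ f bounded_clinear_scaleC_right[of a], unfolded eq]
  show "a *\<^sub>C f \<in> right_nuclear p U" by (rule comp) simp
  have "onorm (\<lambda>v::'f. a *\<^sub>C v) \<le> cmod a"
    by (rule onorm_bound) (auto simp: norm_scaleC)
  then have "onorm (\<lambda>v::'f. a *\<^sub>C v) * right_nuclear_norm p U f \<le> cmod a * right_nuclear_norm p U f"
    using right_nuclear_norm_nonneg[OF p f] by (rule mult_right_mono)
  with comp(2) show "right_nuclear_norm p U (a *\<^sub>C f) \<le> cmod a * right_nuclear_norm p U f"
    by (meson order_trans image_subsetI)
qed

lemma right_nuclear_zero:
  assumes p: "1 \<le> p" and U: "open U"
  shows "(0 :: 'e::complex_normed_vector \<Rightarrow> 'f::cbanach) \<in> right_nuclear p U"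
    and "right_nuclear_norm p U (0 :: 'e \<Rightarrow> 'f) = 0"
proof -
  have "(0 :: 'e \<Rightarrow> 'f) = 0 \<odot> 0"
    by (simp add: rank_one_def fun_eq_iff)
  with rank_one_right_nuclear[OF p U complex_vector.subspace_0[OF subspace_Hinf], of "0::'f"]
  show "(0 :: 'e \<Rightarrow> 'f) \<in> right_nuclear p U" "right_nuclear_norm p U (0 :: 'e \<Rightarrow> 'f) = 0"
    by simp_all
qed

text \<open>
  The series \<open>f + g + 0 + 0 + \<dots>\<close>, where an arbitrarily small excess \<open>e\<close> is spread over the terms
  because countable subadditivity asks for strict bounds.
\<close>

lemma right_nuclear_add:
  fixes f g :: "'e::complex_normed_vector \<Rightarrow> 'f::cbanach"
  assumes p: "1 \<le> p" and U: "open U" and f: "f \<in> right_nuclear p U" and g: "g \<in> right_nuclear p U"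
  shows "f + g \<in> right_nuclear p U"
    and "right_nuclear_norm p U (f + g) \<le> right_nuclear_norm p U f + right_nuclear_norm p U g"
proof -
  let ?\<nu> = "right_nuclear_norm p U :: ('e \<Rightarrow> 'f) \<Rightarrow> real"
  have main: "f + g \<in> right_nuclear p U \<and> ?\<nu> (f + g) \<le> ?\<nu> f + ?\<nu> g + e" if e: "0 < e" for e
  proof -
    define F where "F j = (if j = 0 then f else if j = 1 then g else 0)" for j :: nat
    define b where "b = (\<lambda>j. ?\<nu> (F j) + e * (1 / 2) ^ Suc j)"
    have "(\<lambda>j. ?\<nu> (F j)) sums (\<Sum>j\<in>{0, 1}. ?\<nu> (F j))"
      by (rule sums_finite) (auto simp: F_def right_nuclear_zero(2)[OF p U])
    moreover have "(\<lambda>j. e * (1 / 2) ^ Suc j) sums (e * 1)"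
      by (intro sums_mult power_half_series)
    ultimately have "b sums ((\<Sum>j\<in>{0, 1}. ?\<nu> (F j)) + e * 1)"
      unfolding b_def by (rule sums_add)
    then have b: "b sums (?\<nu> f + ?\<nu> g + e)" by (simp add: F_def)
    have "F j \<in> right_nuclear p U" "?\<nu> (F j) < b j" for j
      using f g e right_nuclear_zero(1)[OF p U] by (auto simp: F_def b_def)
    then obtain H where H: "H \<in> right_nuclear p U" "?\<nu> H \<le> suminf b" "\<And>x. (\<lambda>j. F j x) sums H x"
      using right_nuclear_suminf[OF p U] b sums_summable by metis
    have "(\<lambda>j. F j x) sums (\<Sum>j\<in>{0, 1}. F j x)" for x
      by (rule sums_finite) (auto simp: F_def)
    then have "H = f + g"
      using H(3) sums_unique2 by (fastforce simp: F_def fun_eq_iff)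
    with H b show ?thesis by (simp add: sums_iff)
  qed
  show "f + g \<in> right_nuclear p U" using main[of 1] by simp
  show "?\<nu> (f + g) \<le> ?\<nu> f + ?\<nu> g" by (rule field_le_epsilon) (simp add: main)
qed

lemma norm_on_right_nuclear:
  assumes p: "1 \<le> p" and U: "open U"
  shows "norm_on (right_nuclear p U)
    (right_nuclear_norm p U :: ('e::complex_normed_vector \<Rightarrow> 'f::cbanach) \<Rightarrow> real)"
  unfolding norm_on_def
proof (intro conjI ballI allI)
  fix f g :: "'e \<Rightarrow> 'f" and c assume f: "f \<in> right_nuclear p U"
  show "0 \<le> right_nuclear_norm p U f" by (rule right_nuclear_norm_nonneg[OF p f])
  show "right_nuclear_norm p U f = 0 \<longleftrightarrow> f = 0"
  proof
    assume "right_nuclear_norm p U f = 0"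
    then have "sup_norm U f \<le> 0"
      using sup_norm_le_right_nuclear_norm[OF p f] by simp
    moreover have "norm (f x) \<le> sup_norm U f" for x
      using f by (intro norm_le_sup_norm) (simp add: right_nuclear_def)
    ultimately have "norm (f x) \<le> 0" for x by (rule order_trans[rotated])
    then show "f = 0" by (simp add: fun_eq_iff)
  qed (simp add: right_nuclear_zero(2)[OF p U])
  show "right_nuclear_norm p U (c *\<^sub>C f) = cmod c * right_nuclear_norm p U f"
  proof (cases "c = 0")
    case True
    then show ?thesis by (simp add: right_nuclear_zero(2)[OF p U])
  next
    case False
    have "right_nuclear_norm p U (inverse c *\<^sub>C (c *\<^sub>C f))
        \<le> cmod (inverse c) * right_nuclear_norm p U (c *\<^sub>C f)"
      by (intro right_nuclear_scale[OF p U] f)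
    then have "cmod c * right_nuclear_norm p U f \<le> right_nuclear_norm p U (c *\<^sub>C f)"
      using False by (simp add: scaleC_scaleC scaleC_one norm_divide field_simps)
    with right_nuclear_scale(2)[OF p U f] show ?thesis by (rule antisym)
  qed
qed (rule right_nuclear_add(2)[OF p U])

lemma subspace_right_nuclear:
  assumes p: "1 \<le> p" and U: "open U"
  shows "complex_vector.subspace
    (right_nuclear p U :: ('e::complex_normed_vector \<Rightarrow> 'f::cbanach) set)"
  by (rule complex_vector.subspaceI)
     (rule right_nuclear_zero(1)[OF p U] right_nuclear_add(1)[OF p U]
       right_nuclear_scale(1)[OF p U]; assumption)+

text \<open>
  A normed space is complete if absolutely convergent series converge. Along a sequence of indices with geometrically
  decreasing distances, the differences \<open>h j\<close> form such a series; countable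
  subadditivity provides the sums \<open>F m\<close> of its tails together with bounds on their norms.
\<close>

lemma complete_on_right_nuclear:
  assumes p: "1 \<le> p" and U: "open U"
  shows "complete_on (right_nuclear p U)
    (right_nuclear_norm p U :: ('e::complex_normed_vector \<Rightarrow> 'f::cbanach) \<Rightarrow> real)"
  unfolding complete_on_def
proof (intro allI impI)
  let ?\<nu> = "right_nuclear_norm p U :: ('e \<Rightarrow> 'f) \<Rightarrow> real"
  fix s :: "nat \<Rightarrow> 'e \<Rightarrow> 'f"
  assume "range s \<subseteq> right_nuclear p U \<and> (\<forall>e>0. \<exists>M. \<forall>m\<ge>M. \<forall>n\<ge>M. ?\<nu> (s m - s n) < e)"
  then have s: "\<And>n. s n \<in> right_nuclear p U"
    and Cauchy: "\<And>e. 0 < e \<Longrightarrow> \<exists>M. \<forall>m\<ge>M. \<forall>n\<ge>M. ?\<nu> (s m - s n) < e"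
    by auto
  have "\<forall>j. \<exists>M. \<forall>m\<ge>M. \<forall>n\<ge>M. ?\<nu> (s m - s n) < (1 / 2) ^ Suc j"
    by (intro allI Cauchy) simp
  then obtain M where M: "\<And>j m n. M j \<le> m \<Longrightarrow> M j \<le> n \<Longrightarrow> ?\<nu> (s m - s n) < (1 / 2) ^ Suc j"
    by metis
  \<comment> \<open>Partial sums turn the thresholds \<open>M j\<close> into monotone ones.\<close>
  define r where "r j = (\<Sum>i\<le>j. M i)" for j
  have r: "M j \<le> r j" "r j \<le> r (Suc j)" for j
    by (auto simp: r_def intro: member_le_sum)
  define h where "h j = s (r (Suc j)) - s (r j)" for j
  have h: "h j \<in> right_nuclear p U" for j
    unfolding h_def by (intro complex_vector.subspace_diff subspace_right_nuclear p U s)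
  have h_less: "?\<nu> (h j) < (1 / 2) ^ Suc j" for j
    unfolding h_def by (rule M[OF order_trans[OF r] r(1)])
  have "\<exists>F. F \<in> right_nuclear p U \<and> ?\<nu> F \<le> (1 / 2) ^ m \<and> (\<forall>x. (\<lambda>j. h (j + m) x) sums F x)" for m
  proof -
    have geom: "(\<lambda>j. (1 / 2 :: real) ^ Suc (j + m)) sums (1 / 2) ^ m"
      using sums_mult[OF power_half_series, of "(1 / 2) ^ m"] by (simp add: power_add mult_ac)
    obtain F where "F \<in> right_nuclear p U" "?\<nu> F \<le> (\<Sum>j. (1 / 2) ^ Suc (j + m))"
      "\<And>x. (\<lambda>j. h (j + m) x) sums F x"
      using right_nuclear_suminf[OF p U h h_less sums_summable[OF geom]] by blast
    then show ?thesis unfolding sums_unique[OF geom, symmetric] by blast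
  qed
  then obtain F where F: "\<And>m. F m \<in> right_nuclear p U" "\<And>m. ?\<nu> (F m) \<le> (1 / 2) ^ m"
    "\<And>m x. (\<lambda>j. h (j + m) x) sums F m x"
    by metis
  define l where "l = s (r 0) + F 0"
  have l: "l \<in> right_nuclear p U"
    unfolding l_def by (intro complex_vector.subspace_add subspace_right_nuclear p U s F)
  have tail: "l - s (r m) = F m" for m
  proof
    fix x
    have "(\<Sum>j<m. h j x) = s (r m) x - s (r 0) x"
      unfolding h_def by (simp add: sum_lessThan_telescope[of "\<lambda>j. s (r j) x"])
    moreover have "(\<lambda>j. h (j + m) x) sums (F 0 x - (\<Sum>j<m. h j x))"
      by (rule sums_split_initial_segment) (use F(3)[of 0 x] in simp)
    then have "F m x = F 0 x - (\<Sum>j<m. h j x)"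
      using F(3) sums_unique2 by blast
    ultimately show "(l - s (r m)) x = F m x" by (simp add: l_def)
  qed
  have "(\<lambda>n. ?\<nu> (s n - l)) \<longlonglongrightarrow> 0"
  proof (rule tendstoI)
    fix e :: real assume e: "0 < e"
    obtain m where m: "(1 / 2) ^ m < e / 2"
      using e real_arch_pow_inv[of "e / 2" "1 / 2"] by auto
    have "dist (?\<nu> (s n - l)) 0 < e" if n: "r m \<le> n" for n
    proof -
      have d: "s n - s (r m) \<in> right_nuclear p U"
        by (intro complex_vector.subspace_diff subspace_right_nuclear p U s)
      have "s n - l = (s n - s (r m)) + (-1) *\<^sub>C F m"
        by (simp add: tail[symmetric] complex_vector.scale_minus_left)
      then have "?\<nu> (s n - l) \<le> ?\<nu> (s n - s (r m)) + ?\<nu> ((-1) *\<^sub>C F m)"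
        using right_nuclear_add(2)[OF p U d right_nuclear_scale(1)[OF p U F(1)]] by (simp only:)
      also have "\<dots> \<le> (1 / 2) ^ Suc m + (1 / 2) ^ m"
        using M[of m n "r m"] r(1)[of m] n right_nuclear_scale(2)[OF p U F(1), of "-1" m] F(2)[of m]
        by (intro add_mono) auto
      also have "\<dots> \<le> 2 * (1 / 2) ^ m" by simp
      also have "\<dots> < e" using m by simp
      finally show ?thesis
        using right_nuclear_norm_nonneg[OF p, of "s n - l"] 
          complex_vector.subspace_diff[OF subspace_right_nuclear[OF p U] s l]
        by (simp add: dist_real_def)
    qed
    then show "\<forall>\<^sub>F n in sequentially. dist (?\<nu> (s n - l)) 0 < e"
      unfolding eventually_sequentially by blast
  qed
  with l show "\<exists>l\<in>right_nuclear p U. (\<lambda>n. ?\<nu> (s n - l)) \<longlonglongrightarrow> 0" by blast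
qed

theorem corollary1p16:
  fixes p :: real
  assumes "1 \<le> p"
  shows "banach_bounded_holomorphic_ideal
    (right_nuclear p :: 'e::cbanach set \<Rightarrow> ('e \<Rightarrow> 'f::cbanach) set)
    (right_nuclear_norm p)
    (right_nuclear p :: 'h::cbanach set \<Rightarrow> ('h \<Rightarrow> 'g::cbanach) set)
    (right_nuclear_norm p)"
  unfolding banach_bounded_holomorphic_ideal_def bounded_holomorphic_ideal_def banach_space_on_def
proof (intro conjI allI impI ballI)
  show "right_nuclear p U \<subseteq> Hinf U" for U :: "'e set"
    by (auto simp: right_nuclear_def)
qed (use assms in \<open>auto intro: subspace_right_nuclear norm_on_right_nuclear complete_on_right_nuclear
    sup_norm_le_right_nuclear_norm rank_one_right_nuclear right_nuclear_compose\<close>)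

end
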